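(* Let $d\ge2$. Assume that for some $r>d$ there exist constants $\alpha,\beta>0$ such that $\mathbb{P}(\tau_e\ge t)\le\beta e^{-\alpha t^r}$ for all $t\ge0$, and that $\tau_e$ is unbounded, i.e. $\mathbb{P}(\tau_e>m)>0$ for every $m>0$. For $\xi>0$ let $$\overline{I}(\xi)=\limsup_{n\to\infty}\Big(-\frac{1}{n^d}\log\mathbb{P}\big(\mathrm{T}(0,n\mathbf{e}_1)>(\mu(\mathbf{e}_1)+\xi)n\big)\Big).$$ Then $$\limsup_{\xi\to0+}\ \xi^{-d}\,\overline{I}(\xi)<\infty.$$
   Context: First-passage percolation on $\mathbb{Z}^d$. Let $E(\mathbb{Z}^d)$ be the set of undirected nearest-neighbor edges $\{v,w\}$, $|v-w|_1=1$. To each edge $e$ is attached a non-negative random variable $\tau_e$; the family $(\tau_e)$ is independent and identically distributed. A path is a finite sequence of vertices whose successive elements are nearest neighbors; it is also viewed as its set of edges, and its passage time is $\mathrm{T}(\gamma)=\sum_{e\in\gamma}\tau_e$. For $x,y\in\mathbb{R}^d$, $\mathrm{T}(x,y)$ is the infimum of $\mathrm{T}(\gamma)$ over all finite paths from $\lfloor x\rfloor$ to $\lfloor y\rfloor$ (coordinatewise floor). The time constant is the non-random a.s. limit $\mu(x)=\lim_{t\to\infty}t^{-1}\mathrm{T}(0,tx)$, which exists when $\mathbb{E}\tau_e<\infty$. $\mathbf{e}_1$ is the first canonical basis vector. *)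

theory Defs
  imports "HOL-Probability.Probability"
begin

definition lattice_edges :: "(int ^ 'd::finite) set set" where
  "lattice_edges = {{v, w} | v w. (\<Sum>i\<in>UNIV. \<bar>v $ i - w $ i\<bar>) = 1}"

text \<open>A path is a nonempty list of vertices; one-vertex paths (with no edges) are included.\<close>

definition lattice_paths :: "int ^ 'd::finite \<Rightarrow> int ^ 'd \<Rightarrow> (int ^ 'd) list set" where
  "lattice_paths v w = {p. p \<noteq> [] \<and> hd p = v \<and> last p = w \<and>
     (\<forall>i. Suc i < length p \<longrightarrow> {p ! i, p ! Suc i} \<in> lattice_edges)}"

definition path_edges :: "(int ^ 'd::finite) list \<Rightarrow> (int ^ 'd) set set" where
  "path_edges p = {{p ! i, p ! Suc i} | i. Suc i < length p}"

text \<open>The passage time sums over the set of edges of a path: an edge that is crossed several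
  times is counted once. The argument \<open>w\<close> is one realization of the edge weights.\<close>

definition path_time :: "((int ^ 'd) set \<Rightarrow> real) \<Rightarrow> (int ^ 'd::finite) list \<Rightarrow> real" where
  "path_time w p = (\<Sum>e\<in>path_edges p. w e)"

definition floor_vec :: "real ^ 'd::finite \<Rightarrow> int ^ 'd" where
  "floor_vec x = (\<chi> i. \<lfloor>x $ i\<rfloor>)"

definition passage_time ::
  "((int ^ 'd) set \<Rightarrow> real) \<Rightarrow> real ^ 'd::finite \<Rightarrow> real ^ 'd \<Rightarrow> real" where
  "passage_time w x y = (INF p\<in>lattice_paths (floor_vec x) (floor_vec y). path_time w p)"

definition time_constant ::
  "'a measure \<Rightarrow> ((int ^ 'd) set \<Rightarrow> 'a \<Rightarrow> real) \<Rightarrow> real ^ 'd::finite \<Rightarrow> real" where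
  "time_constant M \<tau> x = (THE m. AE \<omega> in M.
     ((\<lambda>t::real. passage_time (\<lambda>e. \<tau> e \<omega>) 0 (t *\<^sub>R x) / t) \<longlongrightarrow> m) at_top)"

text \<open>The real logarithm satisfies \<open>ln 0 = 0\<close>; here \<open>- log 0\<close> is infinite.\<close>

definition neg_log :: "real \<Rightarrow> ereal" where
  "neg_log p = (if p = 0 then \<infinity> else ereal (- ln p))"

text \<open>A finite index type carries no order, so the coordinate direction \<open>k\<close> is a parameter;
  it plays the role of the first coordinate.\<close>

definition upper_rate ::
  "'a measure \<Rightarrow> ((int ^ 'd) set \<Rightarrow> 'a \<Rightarrow> real) \<Rightarrow> 'd::finite \<Rightarrow> real \<Rightarrow> ereal" where
  "upper_rate M \<tau> k \<xi> = limsup (\<lambda>n::nat.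
     ereal (1 / real n ^ CARD('d)) *
     neg_log (\<P>(\<omega> in M. passage_time (\<lambda>e. \<tau> e \<omega>) 0 (real n *\<^sub>R axis k 1)
                       > (time_constant M \<tau> (axis k 1) + \<xi>) * real n)))"

end

theory Submission
  imports Defs "HOL-Real_Asymp.Real_Asymp"
begin

text \<open>A slow ball of radius of order \<open>\<xi> n\<close> around the origin realizes the deviation: forcing all
  of its edges above a large constant costs a probability \<open>exp (- C \<xi>\<^sup>d n\<^sup>d)\<close>, and then every
  path pays an extra time of order \<open>\<xi> n\<close> to leave the ball. Outside the ball, and independently of
  it, the remaining travel time is at least \<open>(\<mu> - O(\<xi>)) n\<close> with probability at least \<open>1/2\<close>, because
  the unmodified travel time is typically at least \<open>(\<mu> - \<xi>) n\<close>, while by a Chernoff bound all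
  points of the ball are within distance \<open>O(\<xi> n)\<close> of the origin.

  The existence of the time constant is the subadditive ergodic theorem along a coordinate axis. Here the
  Kolmogorov 0-1 law replaces ergodicity, and both the lower and the upper bound follow from the
  covering argument of Katznelson and Weiss; for the upper bound it is applied to sums of travel times
  minimized over finite sets of paths, so that each summand depends on finitely many edges.\<close>

section \<open>Lattice paths and passage times\<close>

text \<open>\<open>time_constant\<close> is a definite description, so it has a usable value only
  once the almost sure limit is known to exist; this is why convergence is proved from scratch and
  then matched with that definition.

  The obstacle in the slow ball argument is dependence: typical travel times also use the weights
  inside the ball. Setting these weights to zero gives a time that is a function of the exterior
  alone, hence independent of the ball being slow, and it loses at most the largest distance from
  the origin to a point of the ball. With radius \<open>L\<close> of order \<xi> n this loss is at
  most \<open>C * L\<close>, where \<open>C\<close> comes from the weight distribution and not from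
  \<xi>.

  Budget: edges above \<open>C + 3\<close> add \<open>(C + 3) * L\<close>, of which
  \<open>C * L\<close> pays for the zeroing. The remaining \<open>3 * L\<close>, at least 3 \<xi> n,
  beats the 2 \<xi> n between the typical lower bound (mu - \<xi>) n and the target (mu + \<xi>) n.
  As the level \<open>C + 3\<close> is fixed before \<xi>, each slow edge has a constant price, and
  the ball has O((\<xi> n)^d) edges.\<close>

definition l1norm :: "int ^ 'd::finite \<Rightarrow> int" where
  "l1norm v = (\<Sum>i\<in>UNIV. \<bar>v $ i\<bar>)"

text \<open>With absolute values the infimum is over a set bounded below, whatever the sign of the weights.\<close>

definition edist :: "((int ^ 'd) set \<Rightarrow> real) \<Rightarrow> int ^ 'd::finite \<Rightarrow> int ^ 'd \<Rightarrow> real" where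
  "edist w u v = (INF p\<in>lattice_paths u v. path_time (\<lambda>e. \<bar>w e\<bar>) p)"

definition translate :: "int ^ 'd::finite \<Rightarrow> ((int ^ 'd) set \<Rightarrow> real) \<Rightarrow> (int ^ 'd) set \<Rightarrow> real" where
  "translate a w = (\<lambda>e. w ((+) a ` e))"

lemma l1norm_zero [simp]: "l1norm 0 = 0"
  by (simp add: l1norm_def)

lemma l1norm_nonneg: "0 \<le> l1norm v"
  by (simp add: l1norm_def sum_nonneg)

lemma l1norm_eq_0_iff: "l1norm v = 0 \<longleftrightarrow> v = 0"
  by (simp add: l1norm_def sum_nonneg_eq_0_iff vec_eq_iff)

lemma l1norm_triangle: "l1norm (u + v) \<le> l1norm u + l1norm v"
  by (simp add: l1norm_def sum.distrib [symmetric] sum_mono)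

lemma l1norm_minus_commute: "l1norm (u - v) = l1norm (v - u)"
  by (simp add: l1norm_def abs_minus_commute)

lemma l1norm_axis: "l1norm (axis k x) = \<bar>x\<bar>"
  by (simp add: l1norm_def axis_def if_distrib cong: if_cong)

lemma component_le_l1norm: "\<bar>v $ i\<bar> \<le> l1norm v"
  unfolding l1norm_def by (rule member_le_sum) auto

lemma lattice_edges_iff: "{v, w} \<in> lattice_edges \<longleftrightarrow> l1norm (v - w) = 1"
  unfolding lattice_edges_def l1norm_def
  by (auto simp: doubleton_eq_iff abs_minus_commute)

lemma lattice_edgesE:
  assumes "e \<in> lattice_edges"
  obtains v w where "e = {v, w}" "l1norm (v - w) = 1"
  using assms unfolding lattice_edges_def l1norm_def by auto

lemma l1norm_eq_1E:
  assumes "l1norm v = 1"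
  obtains i where "v = axis i 1 \<or> v = - axis i 1"
proof -
  have "v \<noteq> 0" using assms by auto
  then obtain i where i: "v $ i \<noteq> 0" by (auto simp: vec_eq_iff)
  have "1 = \<bar>v $ i\<bar> + (\<Sum>j\<in>UNIV - {i}. \<bar>v $ j\<bar>)"
    using assms by (simp add: l1norm_def sum.remove)
  moreover have "0 \<le> (\<Sum>j\<in>UNIV - {i}. \<bar>v $ j\<bar>)" by (rule sum_nonneg) auto
  ultimately have "\<bar>v $ i\<bar> = 1" "(\<Sum>j\<in>UNIV - {i}. \<bar>v $ j\<bar>) = 0"
    using i by linarith+
  then have "\<forall>j\<in>UNIV - {i}. v $ j = 0" "v $ i = 1 \<or> v $ i = -1"
    by (auto simp: sum_nonneg_eq_0_iff)
  then have "v = axis i 1 \<or> v = - axis i 1"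
    by (auto simp: vec_eq_iff axis_def)
  then show thesis using that by blast
qed

lemma path_edges_simps [simp]:
  "path_edges [] = {}" "path_edges [x] = {}"
  "path_edges (x # y # p) = insert {x, y} (path_edges (y # p))"
proof -
  show "path_edges (x # y # p) = insert {x, y} (path_edges (y # p))"
    unfolding path_edges_def
  proof (intro set_eqI iffI; clarsimp)
    fix i assume "i < Suc (length p)"
      "\<forall>ia. {(x # y # p) ! i, (y # p) ! i} = {(y # p) ! ia, p ! ia} \<longrightarrow> \<not> ia < length p"
    then show "{(x # y # p) ! i, (y # p) ! i} = {x, y}" by (cases i) auto
  next
    fix e assume "e = {x, y} \<or> (\<exists>i. e = {(y # p) ! i, p ! i} \<and> i < length p)"
    then show "\<exists>i. e = {(x # y # p) ! i, (y # p) ! i} \<and> i < Suc (length p)"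
    proof
      assume "e = {x, y}" then show ?thesis by (intro exI[of _ 0]) auto
    next
      assume "\<exists>i. e = {(y # p) ! i, p ! i} \<and> i < length p"
      then obtain i where "e = {(y # p) ! i, p ! i}" "i < length p" by auto
      then show ?thesis by (intro exI[of _ "Suc i"]) auto
    qed
  qed
qed (auto simp: path_edges_def)

lemma finite_path_edges [simp]: "finite (path_edges p)"
  by (induction p rule: induct_list012) auto

lemma path_edges_map: "path_edges (map f p) = (`) f ` path_edges p"
  by (induction p rule: induct_list012) auto

lemma path_edges_append:
  assumes "p \<noteq> []" "q \<noteq> []" "last p = hd q"
  shows "path_edges (p @ tl q) = path_edges p \<union> path_edges q"
  using assms
proof (induction p rule: induct_list012)
  case (2 x)
  then show ?case by (cases q) auto
qed auto

lemma lattice_paths_iff: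
  "p \<in> lattice_paths u v \<longleftrightarrow> p \<noteq> [] \<and> hd p = u \<and> last p = v \<and> path_edges p \<subseteq> lattice_edges"
  unfolding lattice_paths_def path_edges_def by auto

lemma lattice_paths_append:
  assumes "p \<in> lattice_paths u v" "q \<in> lattice_paths v z"
  shows "p @ tl q \<in> lattice_paths u z"
proof -
  have "last (p @ tl q) = last q"
    using assms by (cases q) (auto simp: lattice_paths_iff)
  then show ?thesis using assms path_edges_append[of p q]
    by (auto simp: lattice_paths_iff)
qed

lemma image_translate_lattice_edges: "(+) a ` e \<in> lattice_edges \<longleftrightarrow> e \<in> lattice_edges"
proof -
  have *: "e \<in> lattice_edges \<Longrightarrow> (+) a ` e \<in> lattice_edges" for a :: "int ^ 'a" and e
    by (erule lattice_edgesE) (auto simp: lattice_edges_iff)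
  have "(+) (-a) ` (+) a ` e = e" by (auto simp: image_image)
  with *[of e a] *[of "(+) a ` e" "-a"] show ?thesis by auto
qed

lemma lattice_paths_translate:
  "map ((+) a) p \<in> lattice_paths (a + u) (a + v) \<longleftrightarrow> p \<in> lattice_paths u v"
proof -
  have "(`) ((+) a) ` path_edges p \<subseteq> lattice_edges \<longleftrightarrow> path_edges p \<subseteq> lattice_edges"
    using image_translate_lattice_edges by (auto simp: subset_iff)
  then show ?thesis
    by (auto simp: lattice_paths_iff path_edges_map hd_map last_map)
qed

lemma path_time_translate: "path_time (translate a w) p = path_time w (map ((+) a) p)"
proof -
  have "inj_on ((`) ((+) a)) (path_edges p)"
    by (rule inj_onI) (simp add: inj_image_eq_iff)
  then show ?thesis
    by (simp add: path_time_def path_edges_map translate_def sum.reindex)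
qed

text \<open>A step along any coordinate in which the endpoints still differ lowers their distance by
  one. Only an upper bound on the number of weights is wanted, so the edges need not be shown
  distinct.\<close>

lemma ex_short_path:
  fixes u v :: "int ^ 'd::finite"
  shows "\<exists>p\<in>lattice_paths u v. int (card (path_edges p)) \<le> l1norm (v - u)"
proof -
  have "\<exists>p\<in>lattice_paths u v. card (path_edges p) \<le> n" if "l1norm (v - u) = int n" for n
    using that
  proof (induction n arbitrary: u)
    case 0
    then have "u = v" by (simp add: l1norm_eq_0_iff)
    then show ?case by (intro bexI[of _ "[u]"]) (auto simp: lattice_paths_iff)
  next
    case (Suc n)
    then have "v - u \<noteq> 0" by auto
    then obtain i where i: "(v - u) $ i \<noteq> 0" by (auto simp: vec_eq_iff)
    define s where "s = sgn ((v - u) $ i)"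
    define u' where "u' = u + axis i s"
    have s: "\<bar>s\<bar> = 1" using i by (simp add: s_def abs_sgn_eq)
    have "l1norm (v - u) = \<bar>(v - u) $ i\<bar> + (\<Sum>j\<in>UNIV - {i}. \<bar>(v - u) $ j\<bar>)"
      by (simp add: l1norm_def sum.remove)
    moreover have "l1norm (v - u') = \<bar>(v - u') $ i\<bar> + (\<Sum>j\<in>UNIV - {i}. \<bar>(v - u') $ j\<bar>)"
      by (simp add: l1norm_def sum.remove)
    moreover have "(\<Sum>j\<in>UNIV - {i}. \<bar>(v - u') $ j\<bar>) = (\<Sum>j\<in>UNIV - {i}. \<bar>(v - u) $ j\<bar>)"
      by (rule sum.cong) (auto simp: u'_def axis_def)
    moreover have "\<bar>(v - u') $ i\<bar> = \<bar>(v - u) $ i\<bar> - 1"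
      using i by (auto simp: u'_def s_def sgn_if)
    ultimately have "l1norm (v - u') = int n" using Suc.prems by simp
    from Suc.IH[OF this] obtain p where p: "p \<in> lattice_paths u' v" "card (path_edges p) \<le> n"
      by auto
    then obtain q where q: "p = u' # q" by (cases p) (auto simp: lattice_paths_iff)
    have "{u, u'} \<in> lattice_edges"
      using s unfolding lattice_edges_iff by (subst l1norm_minus_commute) (simp add: u'_def l1norm_axis)
    then have "u # p \<in> lattice_paths u v"
      using p by (auto simp: lattice_paths_iff q)
    moreover have "card (path_edges (u # p)) \<le> Suc n"
      using p by (auto simp: q card_insert_if)
    ultimately show ?case by blast
  qed
  from this[of "nat (l1norm (v - u))"] show ?thesis
    using l1norm_nonneg[of "v - u"] by force
qed

lemma lattice_paths_nonempty: "lattice_paths u v \<noteq> {}"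
  using ex_short_path[of u v] by auto

lemma path_time_nonneg: "(\<And>e. e \<in> path_edges p \<Longrightarrow> 0 \<le> w e) \<Longrightarrow> 0 \<le> path_time w p"
  unfolding path_time_def by (rule sum_nonneg)

lemma edist_bdd_below: "bdd_below ((\<lambda>p. path_time (\<lambda>e. \<bar>w e\<bar>) p) ` P)"
  by (rule bdd_belowI[of _ 0]) (auto intro!: path_time_nonneg)

lemma edist_le: "p \<in> lattice_paths u v \<Longrightarrow> edist w u v \<le> path_time (\<lambda>e. \<bar>w e\<bar>) p"
  unfolding edist_def by (rule cINF_lower[OF edist_bdd_below])

lemma edist_greatest:
  "(\<And>p. p \<in> lattice_paths u v \<Longrightarrow> c \<le> path_time (\<lambda>e. \<bar>w e\<bar>) p) \<Longrightarrow> c \<le> edist w u v"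
  unfolding edist_def by (rule cINF_greatest[OF lattice_paths_nonempty])

lemma edist_nonneg: "0 \<le> edist w u v"
  by (rule edist_greatest) (auto intro!: path_time_nonneg)

lemma edist_self [simp]: "edist w u u = 0"
  using edist_le[of "[u]" u u w] edist_nonneg[of w u u]
  by (auto simp: lattice_paths_iff path_time_def)

lemma edist_less_path:
  assumes "edist w u v < c"
  obtains p where "p \<in> lattice_paths u v" "path_time (\<lambda>e. \<bar>w e\<bar>) p < c"
  using assms edist_greatest[of u v c w] by (meson not_le)

text \<open>Near-optimal paths are concatenated. An edge on both of them is counted once, which with
  nonnegative summands only lowers the total.\<close>

lemma edist_triangle: "edist w u z \<le> edist w u v + edist w v z"
proof (rule field_le_epsilon)
  fix \<epsilon> :: real assume "0 < \<epsilon>"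
  then have "edist w u v < edist w u v + \<epsilon> / 2" "edist w v z < edist w v z + \<epsilon> / 2" by auto
  then obtain p q where p: "p \<in> lattice_paths u v" "path_time (\<lambda>e. \<bar>w e\<bar>) p < edist w u v + \<epsilon> / 2"
    and q: "q \<in> lattice_paths v z" "path_time (\<lambda>e. \<bar>w e\<bar>) q < edist w v z + \<epsilon> / 2"
    by (metis edist_less_path)
  have "edist w u z \<le> path_time (\<lambda>e. \<bar>w e\<bar>) (p @ tl q)"
    by (rule edist_le[OF lattice_paths_append[OF p(1) q(1)]])
  also have "\<dots> \<le> path_time (\<lambda>e. \<bar>w e\<bar>) p + path_time (\<lambda>e. \<bar>w e\<bar>) q"
  proof -
    have "path_edges (p @ tl q) = path_edges p \<union> path_edges q"
      using p(1) q(1) by (intro path_edges_append) (auto simp: lattice_paths_iff)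
    moreover have "0 \<le> (\<Sum>e\<in>path_edges p \<inter> path_edges q. \<bar>w e\<bar>)" by (rule sum_nonneg) auto
    ultimately show ?thesis
      unfolding path_time_def by (simp add: sum_Un)
  qed
  finally show "edist w u z \<le> edist w u v + edist w v z + \<epsilon>" using p q by simp
qed

lemma edist_translate: "edist (translate a w) u v = edist w (a + u) (a + v)"
proof -
  have "lattice_paths (a + u) (a + v) = map ((+) a) ` lattice_paths u v" (is "?L = ?R")
  proof
    show "?R \<subseteq> ?L" by (auto simp: lattice_paths_translate)
    show "?L \<subseteq> ?R"
    proof
      fix p assume "p \<in> ?L"
      moreover have "p = map ((+) a) (map ((+) (-a)) p)" by (simp add: comp_def)
      ultimately show "p \<in> ?R" using lattice_paths_translate by (metis image_eqI)
    qed
  qed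
  moreover have "path_time (\<lambda>e. \<bar>translate a w e\<bar>) p = path_time (\<lambda>e. \<bar>w e\<bar>) (map ((+) a) p)" for p
    using path_time_translate[of a "\<lambda>e. \<bar>w e\<bar>" p] by (simp add: translate_def)
  ultimately show ?thesis unfolding edist_def by (simp add: image_image)
qed

lemma edist_cong:
  "(\<And>e. e \<in> lattice_edges \<Longrightarrow> w e = w' e) \<Longrightarrow> edist w u v = edist w' u v"
  unfolding edist_def path_time_def
  by (intro INF_cong refl sum.cong) (auto simp: lattice_paths_iff)

lemma path_time_change_finite:
  assumes "finite F" "\<And>e. e \<notin> F \<Longrightarrow> w e = w' e"
  shows "path_time (\<lambda>e. \<bar>w e\<bar>) p \<le> path_time (\<lambda>e. \<bar>w' e\<bar>) p + (\<Sum>e\<in>F. \<bar>w e\<bar>)"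
proof -
  have "path_time (\<lambda>e. \<bar>w e\<bar>) p = (\<Sum>e\<in>path_edges p - F. \<bar>w e\<bar>) + (\<Sum>e\<in>path_edges p \<inter> F. \<bar>w e\<bar>)"
    unfolding path_time_def by (subst sum.union_disjoint[symmetric]) (auto intro!: sum.cong)
  moreover have "(\<Sum>e\<in>path_edges p \<inter> F. \<bar>w e\<bar>) \<le> (\<Sum>e\<in>F. \<bar>w e\<bar>)"
    using assms(1) by (intro sum_mono2) auto
  moreover have "(\<Sum>e\<in>path_edges p - F. \<bar>w e\<bar>) = (\<Sum>e\<in>path_edges p - F. \<bar>w' e\<bar>)"
    using assms(2) by (intro sum.cong) auto
  moreover have "\<dots> \<le> path_time (\<lambda>e. \<bar>w' e\<bar>) p"
    unfolding path_time_def by (intro sum_mono2) auto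
  ultimately show ?thesis by linarith
qed

text \<open>A path collects each edge of \<open>F\<close> at most once, so the error is uniform in
  the endpoints. A bounded error of this kind is what makes events about linear growth accessible to
  the zero-one law.\<close>

lemma edist_change_finite:
  assumes "finite F" "\<And>e. e \<notin> F \<Longrightarrow> w e = w' e"
  shows "edist w u v \<le> edist w' u v + (\<Sum>e\<in>F. \<bar>w e\<bar>)"
proof -
  have "edist w u v - (\<Sum>e\<in>F. \<bar>w e\<bar>) \<le> edist w' u v"
  proof (rule edist_greatest)
    fix p assume "p \<in> lattice_paths u v"
    then show "edist w u v - (\<Sum>e\<in>F. \<bar>w e\<bar>) \<le> path_time (\<lambda>e. \<bar>w' e\<bar>) p"
      using edist_le[of p u v w] path_time_change_finite[of F w w' p, OF assms] by simp
  qed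
  then show ?thesis by simp
qed

lemma passage_time_eq_edist:
  assumes "\<And>e. e \<in> lattice_edges \<Longrightarrow> 0 \<le> w e" "\<And>e. e \<in> lattice_edges \<Longrightarrow> w e = w' e"
  shows "passage_time w x y = edist w' (floor_vec x) (floor_vec y)"
  unfolding passage_time_def edist_def path_time_def
  using assms by (intro INF_cong refl sum.cong) (force simp: lattice_paths_iff)+

lemma countable_lattice_edges: "countable (lattice_edges :: (int ^ 'd::finite) set set)"
proof -
  have "(lattice_edges :: (int ^ 'd) set set) \<subseteq> (\<lambda>(v, w). {v, w}) ` UNIV"
    by (auto simp: lattice_edges_def)
  then show ?thesis by (rule countable_subset) auto
qed

lemma infinite_lattice_edges: "infinite (lattice_edges :: (int ^ 'd::finite) set set)"
proof
  assume fin: "finite (lattice_edges :: (int ^ 'd) set set)"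
  fix k :: 'd
  define f :: "int \<Rightarrow> (int ^ 'd) set" where "f n = {axis k n, axis k (n + 1)}" for n
  have "inj f"
    by (rule injI) (auto simp: f_def doubleton_eq_iff axis_eq_axis)
  moreover have "axis k n - axis k (n + 1) = axis k (-1 :: int)" for n
    by (simp add: vec_eq_iff axis_def)
  then have "range f \<subseteq> lattice_edges"
    by (auto simp: f_def lattice_edges_iff l1norm_axis)
  ultimately show False
    using fin finite_subset infinite_UNIV_int finite_imageD by metis
qed

section \<open>Slowing down a ball\<close>

definition l1ball :: "nat \<Rightarrow> (int ^ 'd::finite) set" where
  "l1ball L = {v. l1norm v \<le> int L}"

definition ball_edges :: "nat \<Rightarrow> (int ^ 'd::finite) set set" where
  "ball_edges L = {e \<in> lattice_edges. e \<subseteq> l1ball L}"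

lemma l1ball_finite_card:
  shows "finite (l1ball L :: (int ^ 'd::finite) set)"
    and "card (l1ball L :: (int ^ 'd) set) \<le> (2 * L + 1) ^ CARD('d)"
proof -
  let ?P = "PiE (UNIV :: 'd set) (\<lambda>_. {- int L..int L})"
  have sub: "(l1ball L :: (int ^ 'd) set) \<subseteq> vec_lambda ` ?P"
  proof
    fix v :: "int ^ 'd" assume "v \<in> l1ball L"
    then have "\<bar>v $ i\<bar> \<le> int L" for i
      using component_le_l1norm[of v i] by (simp add: l1ball_def)
    then have "vec_nth v \<in> ?P" by (auto simp: abs_le_iff) (metis minus_le_iff)
    then show "v \<in> vec_lambda ` ?P" by (metis image_eqI vec_nth_inverse)
  qed
  have fin: "finite ?P" by (intro finite_PiE) auto
  then show "finite (l1ball L :: (int ^ 'd) set)" using sub finite_subset by blast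
  have "card (l1ball L :: (int ^ 'd) set) \<le> card ?P"
    using surj_card_le[OF fin sub] .
  also have "card ?P = (2 * L + 1) ^ CARD('d)"
    by (subst card_PiE) (auto simp: nat_add_distrib nat_mult_distrib)
  finally show "card (l1ball L :: (int ^ 'd) set) \<le> (2 * L + 1) ^ CARD('d)" .
qed

text \<open>Each edge is a base vertex together with a coordinate direction. The resulting order
  \<open>L ^ CARD('d)\<close> is the origin of the power of \<xi> in the final rate.\<close>

lemma ball_edges_finite_card:
  shows "finite (ball_edges L :: (int ^ 'd::finite) set set)"
    and "card (ball_edges L :: (int ^ 'd) set set) \<le> (2 * L + 1) ^ CARD('d) * CARD('d)"
proof -
  let ?B = "l1ball L :: (int ^ 'd) set"
  have sub: "ball_edges L \<subseteq> (\<lambda>(v, i). {v, v + axis i 1}) ` (?B \<times> UNIV)"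
  proof
    fix e :: "(int ^ 'd) set" assume e: "e \<in> ball_edges L"
    then obtain v w where vw: "e = {v, w}" "l1norm (v - w) = 1" "v \<in> ?B" "w \<in> ?B"
      by (auto simp: ball_edges_def elim: lattice_edgesE)
    obtain i where "v - w = axis i 1 \<or> v - w = - axis i 1"
      using l1norm_eq_1E[OF vw(2)] by blast
    then have "v = w + axis i 1 \<or> w = v + axis i 1" by (auto simp: algebra_simps)
    then show "e \<in> (\<lambda>(v, i). {v, v + axis i 1}) ` (?B \<times> UNIV)"
      using vw by (auto simp: image_iff)
  qed
  have fin: "finite (?B \<times> (UNIV :: 'd set))" by (intro finite_cartesian_product l1ball_finite_card(1)) simp
  then show "finite (ball_edges L :: (int ^ 'd) set set)" using sub finite_subset by blast
  have "card (ball_edges L :: (int ^ 'd) set set) \<le> card (?B \<times> (UNIV :: 'd set))"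
    using surj_card_le[OF fin sub] .
  also have "\<dots> \<le> (2 * L + 1) ^ CARD('d) * CARD('d)"
    using l1ball_finite_card(2)[where 'd='d] by (simp add: card_cartesian_product)
  finally show "card (ball_edges L :: (int ^ 'd) set set) \<le> (2 * L + 1) ^ CARD('d) * CARD('d)" .
qed

text \<open>A discrete intermediate value argument: the norm changes by at most one along an
  edge.\<close>

lemma path_crosses_level:
  assumes "p \<noteq> []" "path_edges p \<subseteq> lattice_edges" "l1norm (hd p) \<le> l" "l < l1norm (last p)"
  shows "\<exists>x y. {x, y} \<in> path_edges p \<and> l1norm x = l \<and> l1norm y = l + 1"
  using assms
proof (induction p rule: induct_list012)
  case (3 x y q)
  have "{x, y} \<in> lattice_edges" using "3.prems" by auto
  then have "l1norm (y - x) = 1" by (subst l1norm_minus_commute) (simp add: lattice_edges_iff)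
  then have y: "l1norm y \<le> l1norm x + 1" using l1norm_triangle[of "y - x" x] by simp
  show ?case
  proof (cases "l1norm y \<le> l")
    case True
    then show ?thesis using 3 by auto
  next
    case False
    then show ?thesis using y "3.prems" by (intro exI[of _ x] exI[of _ y]) auto
  qed
qed auto

text \<open>For every \<open>l < L\<close> the path has an edge from the sphere of radius
  \<open>l\<close> to that of radius \<open>l + 1\<close>. The norms of its endpoints determine
  \<open>l\<close>, so these edges are distinct, and they all lie in the ball.\<close>

lemma card_path_ball_edges:
  assumes "p \<in> lattice_paths 0 z" "int L \<le> l1norm z"
  shows "L \<le> card (path_edges p \<inter> ball_edges L)"
proof -
  have "\<exists>e. e \<in> path_edges p \<inter> ball_edges L \<and> l1norm ` e = {int l, int l + 1}" if l: "l < L" for l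
  proof -
    obtain x y where xy: "{x, y} \<in> path_edges p" "l1norm x = int l" "l1norm y = int l + 1"
    proof -
      have "p \<noteq> []" "path_edges p \<subseteq> lattice_edges" "l1norm (hd p) \<le> int l" "int l < l1norm (last p)"
        using assms l by (auto simp: lattice_paths_iff)
      from path_crosses_level[OF this] that show ?thesis by blast
    qed
    then have "{x, y} \<in> ball_edges L"
      using assms that by (auto simp: ball_edges_def l1ball_def lattice_paths_iff)
    then show ?thesis using xy by (intro exI[of _ "{x, y}"]) auto
  qed
  then obtain g where g: "\<And>l. l < L \<Longrightarrow> g l \<in> path_edges p \<inter> ball_edges L"
    "\<And>l. l < L \<Longrightarrow> l1norm ` g l = {int l, int l + 1}"
    by metis
  have "inj_on g {..<L}"
  proof (rule inj_onI)
    fix a b assume "a \<in> {..<L}" "b \<in> {..<L}" "g a = g b"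
    then have "{int a, int a + 1} = {int b, int b + 1}" using g(2) by (metis lessThan_iff)
    then show "a = b" by (auto simp: doubleton_eq_iff)
  qed
  then have "card (g ` {..<L}) = L" by (simp add: card_image)
  moreover have "g ` {..<L} \<subseteq> path_edges p \<inter> ball_edges L" using g by auto
  ultimately show ?thesis by (metis card_mono finite_Int finite_path_edges)
qed

text \<open>\<open>q\<close> is the part of the path after its last edge inside the ball; that edge
  ends at a point \<open>y\<close> of the ball. The induction peels off the front, so the last ball
  edge is the first one found from the back.\<close>

lemma path_last_exit:
  assumes "p \<noteq> []" "path_edges p \<subseteq> lattice_edges"
  shows "path_edges p \<inter> ball_edges L = {} \<or>
    (\<exists>y q. y \<in> l1ball L \<and> q \<in> lattice_paths y (last p) \<and> path_edges q \<subseteq> path_edges p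
      \<and> path_edges q \<inter> ball_edges L = {})"
  using assms
proof (induction p rule: induct_list012)
  case (3 x y q)
  then consider "path_edges (y # q) \<inter> ball_edges L = {}" |
    "\<exists>z q'. z \<in> l1ball L \<and> q' \<in> lattice_paths z (last (y # q)) \<and> path_edges q' \<subseteq> path_edges (y # q)
      \<and> path_edges q' \<inter> ball_edges L = {}"
    by auto
  then show ?case
  proof cases
    case 1
    show ?thesis
    proof (cases "{x, y} \<in> ball_edges L")
      case True
      then have "y \<in> l1ball L" by (auto simp: ball_edges_def)
      then show ?thesis using 1 "3.prems"
        by (intro disjI2 exI[of _ y] exI[of _ "y # q"]) (auto simp: lattice_paths_iff)
    next
      case False
      then show ?thesis using 1 by auto
    qed
  next
    case 2
    then show ?thesis by (intro disjI2) (auto; blast)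
  qed
qed auto

text \<open>The two terms count disjoint edges of a path: the ball edges, of which there are at
  least \<open>L\<close>, and the others, which are all that the zeroed weights \<open>w'\<close>
  see.\<close>

lemma edist_ball_lower:
  fixes z :: "int ^ 'd::finite"
  assumes z: "int L \<le> l1norm z"
    and m: "\<And>e. e \<in> ball_edges L \<Longrightarrow> m \<le> \<bar>w e\<bar>" "0 \<le> m"
    and w': "\<And>e. w' e = (if e \<in> ball_edges L then 0 else w e)"
  shows "m * real L + edist w' 0 z \<le> edist w 0 z"
proof (rule edist_greatest)
  fix p assume p: "p \<in> lattice_paths 0 z"
  let ?F = "ball_edges L :: (int ^ 'd) set set"
  have "m * real L \<le> m * real (card (path_edges p \<inter> ?F))"
    using card_path_ball_edges[OF p z] m(2) by (intro mult_left_mono) auto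
  also have "\<dots> = (\<Sum>e\<in>path_edges p \<inter> ?F. m)" by simp
  also have "\<dots> \<le> (\<Sum>e\<in>path_edges p \<inter> ?F. \<bar>w e\<bar>)" using m by (intro sum_mono) auto
  finally have 1: "m * real L \<le> (\<Sum>e\<in>path_edges p \<inter> ?F. \<bar>w e\<bar>)" .
  have "edist w' 0 z \<le> path_time (\<lambda>e. \<bar>w' e\<bar>) p" by (rule edist_le[OF p])
  also have "\<dots> = (\<Sum>e\<in>path_edges p - ?F. \<bar>w e\<bar>)"
    unfolding path_time_def by (rule sum.mono_neutral_cong_right) (auto simp: w')
  also have "m * real L + (\<Sum>e\<in>path_edges p - ?F. \<bar>w e\<bar>)
      \<le> (\<Sum>e\<in>path_edges p \<inter> ?F. \<bar>w e\<bar>) + (\<Sum>e\<in>path_edges p - ?F. \<bar>w e\<bar>)"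
    using 1 by simp
  also have "\<dots> = path_time (\<lambda>e. \<bar>w e\<bar>) p"
    unfolding path_time_def by (subst sum.union_disjoint[symmetric]) (auto intro!: sum.cong)
  finally show "m * real L + edist w' 0 z \<le> path_time (\<lambda>e. \<bar>w e\<bar>) p" by simp
qed

text \<open>Whatever a path does before its last exit from the ball can be replaced by a route from
  0 to the exit point of cost at most \<open>C\<close>; after the exit \<open>w\<close> and
  \<open>w'\<close> agree.\<close>

lemma edist_exit_lower:
  fixes z :: "int ^ 'd::finite"
  assumes C: "\<And>y. y \<in> l1ball L \<Longrightarrow> edist w 0 y \<le> C"
    and w': "\<And>e. w' e = (if e \<in> ball_edges L then 0 else w e)"
  shows "edist w 0 z - C \<le> edist w' 0 z"
proof (rule edist_greatest)
  fix p assume p: "p \<in> lattice_paths 0 z"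
  \<comment> \<open>Covers the paths without ball edges: there the exit point is the origin and
    \<open>q\<close> is the whole path.\<close>
  have "0 \<in> l1ball L" by (simp add: l1ball_def)
  then obtain y q where q: "y \<in> l1ball L" "q \<in> lattice_paths y z" "path_edges q \<subseteq> path_edges p"
    "path_edges q \<inter> ball_edges L = {}"
    using path_last_exit[of p L] p unfolding lattice_paths_iff by blast
  have "edist w 0 z \<le> edist w 0 y + edist w y z" by (rule edist_triangle)
  also have "edist w y z \<le> path_time (\<lambda>e. \<bar>w e\<bar>) q" by (rule edist_le[OF q(2)])
  also have "\<dots> = path_time (\<lambda>e. \<bar>w' e\<bar>) q"
    unfolding path_time_def using q by (intro sum.cong) (auto simp: w')
  also have "\<dots> \<le> path_time (\<lambda>e. \<bar>w' e\<bar>) p"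
    unfolding path_time_def using q by (intro sum_mono2) auto
  finally show "edist w 0 z - C \<le> path_time (\<lambda>e. \<bar>w' e\<bar>) p" using C[OF q(1)] by simp
qed

section \<open>The covering argument of Katznelson and Weiss\<close>

text \<open>Walk from \<open>j\<close> to \<open>n\<close>, jumping over good stretches for free.\<close>

lemma subadditive_cover:
  fixes X :: "nat \<Rightarrow> nat \<Rightarrow> real"
  assumes sub: "\<And>i j k. i \<le> j \<Longrightarrow> j \<le> k \<Longrightarrow> X i k \<le> X i j + X j k"
    and zero: "\<And>i. X i i = 0"
    and step: "\<And>j. X j (Suc j) \<le> b j" "\<And>j. 0 \<le> b j"
    and good: "\<And>j. G j \<Longrightarrow> \<exists>N\<in>{1..K}. X j (j + N) \<le> 0"
    and "j \<le> n"
  shows "X j n \<le> (\<Sum>i\<in>{j..<n}. if G i then 0 else b i) + (\<Sum>i\<in>{n - K..<n}. b i)"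
  using \<open>j \<le> n\<close>
proof (induction "n - j" arbitrary: j rule: less_induct)
  case less
  have sum_le: "X i n \<le> (\<Sum>l\<in>{i..<n}. b l)" if "i \<le> n" for i
    using that
  proof (induction i rule: inc_induct)
    case (step i)
    then have "X i n \<le> b i + X (Suc i) n" using sub[of i "Suc i" n] assms(3)[of i] by simp
    then show ?case using step by (simp add: sum.atLeast_Suc_lessThan)
  qed (simp add: zero)
  show ?case
  proof (cases "j = n")
    case True
    then show ?thesis using step by (auto simp: zero intro!: sum_nonneg)
  next
    case False
    then have jn: "j < n" using less.prems by simp
    show ?thesis
    proof (cases "G j")
      case True
      then obtain N where N: "1 \<le> N" "N \<le> K" "X j (j + N) \<le> 0" using good[OF True] by auto
      show ?thesis
      proof (cases "j + N \<le> n")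
        case True
        have "X j n \<le> X (j + N) n" using sub[of j "j + N" n] True N by simp
        also have "\<dots> \<le> (\<Sum>i\<in>{j + N..<n}. if G i then 0 else b i) + (\<Sum>i\<in>{n - K..<n}. b i)"
          using less.hyps[of "j + N"] jn N True by simp
        also have "(\<Sum>i\<in>{j + N..<n}. if G i then 0 else b i) \<le> (\<Sum>i\<in>{j..<n}. if G i then 0 else b i)"
          using step by (intro sum_mono2) auto
        finally show ?thesis by simp
      next
        \<comment> \<open>The free jump would overshoot \<open>n\<close>. As
          \<open>N \<le> K\<close>, all remaining indices lie among the last \<open>K\<close>, so
          the boundary sum pays for them step by step.\<close>
        case False
        have "X j n \<le> (\<Sum>l\<in>{j..<n}. b l)" using sum_le less.prems by simp
        also have "\<dots> \<le> (\<Sum>i\<in>{n - K..<n}. b i)"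
          using step N False by (intro sum_mono2) auto
        moreover have "0 \<le> (\<Sum>i\<in>{j..<n}. if G i then 0 else b i)"
          using step by (intro sum_nonneg) auto
        ultimately show ?thesis by simp
      qed
    next
      case False
      have "X j n \<le> b j + X (Suc j) n" using sub[of j "Suc j" n] step(1)[of j] jn by simp
      also have "X (Suc j) n \<le> (\<Sum>i\<in>{Suc j..<n}. if G i then 0 else b i) + (\<Sum>i\<in>{n - K..<n}. b i)"
        using less.hyps[of "Suc j"] jn by simp
      finally show ?thesis using False jn by (simp add: sum.atLeast_Suc_lessThan)
    qed
  qed
qed

text \<open>Expectations are taken in the pathwise covering bound. An index is bad when no free
  stretch of length at most \<open>K\<close> starts there; almost surely such a stretch of some
  length exists, so the mean cost of a bad index tends to 0 as \<open>K\<close> grows, by dominated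
  convergence. The last \<open>K\<close> indices contribute the constant. Stationarity enters
  through the two equalities of means.\<close>

lemma (in prob_space) expectation_cover:
  fixes X :: "nat \<Rightarrow> nat \<Rightarrow> 'a \<Rightarrow> real" and b :: "nat \<Rightarrow> 'a \<Rightarrow> real"
  assumes sub: "\<And>i j k \<omega>. i \<le> j \<Longrightarrow> j \<le> k \<Longrightarrow> X i k \<omega> \<le> X i j \<omega> + X j k \<omega>"
    and zero: "\<And>i \<omega>. X i i \<omega> = 0"
    and step: "\<And>j \<omega>. X j (Suc j) \<omega> \<le> b j \<omega>" "\<And>j \<omega>. 0 \<le> b j \<omega>"
    and int: "\<And>i j. integrable M (X i j)" "\<And>j. integrable M (b j)"
    and stat: "\<And>j. expectation (b j) = expectation (b 0)"
      "\<And>K j. expectation (\<lambda>\<omega>. if \<exists>N\<in>{1..K}. X j (j + N) \<omega> \<le> 0 then 0 else b j \<omega>)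
          = expectation (\<lambda>\<omega>. if \<exists>N\<in>{1..K}. X 0 N \<omega> \<le> 0 then 0 else b 0 \<omega>)"
    and ae: "AE \<omega> in M. \<exists>N\<ge>1. X 0 N \<omega> \<le> 0"
    and "0 < \<delta>"
  shows "\<exists>C. \<forall>n. expectation (X 0 n) \<le> \<delta> * real n + C"
proof -
  have [measurable]: "X i j \<in> borel_measurable M" "b j \<in> borel_measurable M" for i j
    using int by auto
  define h where "h K j \<omega> = (if \<exists>N\<in>{1..K}. X j (j + N) \<omega> \<le> 0 then 0 else b j \<omega>)" for K j \<omega>
  have [measurable]: "h K j \<in> borel_measurable M" for K j unfolding h_def by measurable
  have h_int: "integrable M (h K j)" for K j
    by (rule Bochner_Integration.integrable_bound[OF int(2)[of j]]) (auto simp: h_def step(2))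
  have "(\<lambda>K. expectation (h K 0)) \<longlonglongrightarrow> expectation (\<lambda>_. 0)"
  proof (rule integral_dominated_convergence[where w = "b 0"])
    show "AE \<omega> in M. (\<lambda>K. h K 0 \<omega>) \<longlonglongrightarrow> 0"
      using ae
    proof eventually_elim
      case (elim \<omega>)
      then obtain N where N: "N \<ge> 1" "X 0 N \<omega> \<le> 0" by auto
      have "eventually (\<lambda>K. h K 0 \<omega> = 0) sequentially"
        using eventually_ge_at_top[of N] by eventually_elim (use N in \<open>auto simp: h_def\<close>)
      then show ?case by (rule tendsto_eventually)
    qed
  qed (auto simp: h_def step(2) int)
  then have "eventually (\<lambda>K. expectation (h K 0) < \<delta>) sequentially"
    using \<open>0 < \<delta>\<close> by (simp add: order_tendsto_iff)
  then obtain K where K: "expectation (h K 0) < \<delta>" by (auto simp: eventually_sequentially)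
  have "expectation (X 0 n) \<le> \<delta> * real n + real K * expectation (b 0)" for n
  proof -
    have "expectation (X 0 n) \<le> expectation (\<lambda>\<omega>. (\<Sum>i\<in>{0..<n}. h K i \<omega>) + (\<Sum>i\<in>{n - K..<n}. b i \<omega>))"
    proof (rule integral_mono)
      fix \<omega>
      show "X 0 n \<omega> \<le> (\<Sum>i\<in>{0..<n}. h K i \<omega>) + (\<Sum>i\<in>{n - K..<n}. b i \<omega>)"
        using subadditive_cover[where X = "\<lambda>i j. X i j \<omega>" and b = "\<lambda>i. b i \<omega>" and K = K and j = 0 and n = n
            and G = "\<lambda>j. \<exists>N\<in>{1..K}. X j (j + N) \<omega> \<le> 0"]
        using sub zero step unfolding h_def by simp
    qed (auto intro!: int h_int)
    also have "\<dots> = (\<Sum>i\<in>{0..<n}. expectation (h K i)) + (\<Sum>i\<in>{n - K..<n}. expectation (b i))"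
      using int h_int by simp
    also have "(\<Sum>i\<in>{0..<n}. expectation (h K i)) = real n * expectation (h K 0)"
    proof -
      have "(\<Sum>i\<in>{0..<n}. expectation (h K i)) = (\<Sum>i\<in>{0..<n}. expectation (h K 0))"
        using stat(2)[of K] by (intro sum.cong refl) (simp add: h_def[abs_def])
      then show ?thesis by simp
    qed
    also have "(\<Sum>i\<in>{n - K..<n}. expectation (b i)) = real (n - (n - K)) * expectation (b 0)"
    proof -
      have "(\<Sum>i\<in>{n - K..<n}. expectation (b i)) = (\<Sum>i\<in>{n - K..<n}. expectation (b 0))"
        using stat(1) by (intro sum.cong) auto
      then show ?thesis by simp
    qed
    also have "\<dots> \<le> real K * expectation (b 0)"
      using step(2) by (intro mult_right_mono integral_nonneg) auto
    also have "real n * expectation (h K 0) \<le> \<delta> * real n"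
      using mult_left_mono[of "expectation (h K 0)" \<delta> "real n"] K by (simp add: mult.commute)
    finally show ?thesis by simp
  qed
  then show ?thesis by blast
qed

section \<open>Independent identically distributed weights\<close>

abbreviation weight_space :: "((int ^ 'd::finite) set \<Rightarrow> real) measure" where
  "weight_space \<equiv> PiM lattice_edges (\<lambda>_. borel)"

lemma measurable_path_time [measurable]:
  assumes "path_edges p \<subseteq> lattice_edges"
  shows "(\<lambda>w. path_time (\<lambda>e. \<bar>w e\<bar>) p) \<in> borel_measurable weight_space"
proof -
  have "(\<lambda>w. \<bar>w e\<bar>) \<in> borel_measurable weight_space" if "e \<in> path_edges p" for e
  proof -
    have "(\<lambda>w. w e) \<in> borel_measurable weight_space"
      using assms that by (intro measurable_component_singleton) auto
    then show ?thesis by measurable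
  qed
  then show ?thesis unfolding path_time_def by (rule borel_measurable_sum)
qed

lemma measurable_edist [measurable]: "(\<lambda>w. edist w u v) \<in> borel_measurable weight_space"
  unfolding edist_def
proof (rule borel_measurable_cINF_real)
  show "countable (lattice_paths u v)" by (rule countableI_type)
qed (auto simp: lattice_paths_iff intro!: measurable_path_time)

lemma measurable_translate [measurable]: "translate a \<in> measurable weight_space weight_space"
proof -
  have "(\<lambda>w. \<lambda>e\<in>lattice_edges. w ((+) a ` e)) \<in> measurable weight_space weight_space"
    by (intro measurable_restrict measurable_component_singleton) (simp add: image_translate_lattice_edges)
  moreover have "translate a w = (\<lambda>e\<in>lattice_edges. w ((+) a ` e))" if "w \<in> space weight_space" for w
    using that by (auto simp: translate_def space_PiM PiE_def extensional_def restrict_def fun_eq_iff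
        image_translate_lattice_edges)
  ultimately show ?thesis by (subst measurable_cong) auto
qed

text \<open>The tail bound is passed on as an exponential moment, which serves both the
  integrability of travel times and the Chernoff bound.\<close>

locale percolation = prob_space M
  for M :: "'a measure" +
  fixes \<tau> :: "(int ^ 'd::finite) set \<Rightarrow> 'a \<Rightarrow> real"
  assumes indep: "indep_vars (\<lambda>_. borel) \<tau> lattice_edges"
    and ident: "\<And>e f. e \<in> lattice_edges \<Longrightarrow> f \<in> lattice_edges \<Longrightarrow> distr M borel (\<tau> e) = distr M borel (\<tau> f)"
    and exp_integrable: "\<And>e. e \<in> lattice_edges \<Longrightarrow> integrable M (\<lambda>\<omega>. exp \<bar>\<tau> e \<omega>\<bar>)"
begin

text \<open>The restriction makes each realization a point of the product space
  \<open>weight_space\<close>, so that environments have a law and translations act on it.\<close>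

definition W :: "'a \<Rightarrow> (int ^ 'd) set \<Rightarrow> real" where
  "W \<omega> = (\<lambda>e\<in>lattice_edges. \<tau> e \<omega>)"

lemma measurable_weight: "e \<in> lattice_edges \<Longrightarrow> \<tau> e \<in> borel_measurable M"
  using indep by (auto simp: indep_vars_def)

lemma measurable_W [measurable]: "W \<in> measurable M weight_space"
  unfolding W_def by (intro measurable_restrict measurable_weight)

text \<open>Stationarity: by independence and identical distribution the law is a power of a single
  measure, and a translation only permutes the factors.\<close>

lemma distr_translate: "distr M weight_space (\<lambda>\<omega>. translate a (W \<omega>)) = distr M weight_space W"
proof -
  obtain e0 :: "(int ^ 'd) set" where e0: "e0 \<in> lattice_edges"
    using infinite_lattice_edges by (metis all_not_in_conv finite.emptyI)
  define \<nu> where "\<nu> = distr M borel (\<tau> e0)"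
  have \<nu>: "prob_space \<nu>" unfolding \<nu>_def by (rule prob_space_distr[OF measurable_weight[OF e0]])
  have "distr M weight_space W = (\<Pi>\<^sub>M e\<in>lattice_edges. distr M borel (\<tau> e))"
    unfolding W_def using indep e0 measurable_weight
    by (subst indep_vars_iff_distr_eq_PiM'[symmetric]) auto
  also have "\<dots> = (\<Pi>\<^sub>M e\<in>lattice_edges. \<nu>)"
    unfolding \<nu>_def using e0 by (intro PiM_cong refl ident)
  finally have W: "distr M weight_space W = (\<Pi>\<^sub>M e\<in>lattice_edges. \<nu>)" .
  have sets: "sets (\<Pi>\<^sub>M e\<in>(lattice_edges :: (int ^ 'd) set set). \<nu>) = sets weight_space"
    by (intro sets_PiM_cong refl) (simp add: \<nu>_def)
  have "distr M weight_space (\<lambda>\<omega>. translate a (W \<omega>)) = distr (distr M weight_space W) weight_space (translate a)"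
    by (subst distr_distr) (auto simp: comp_def)
  also have "\<dots> = distr (\<Pi>\<^sub>M e\<in>lattice_edges. \<nu>) (\<Pi>\<^sub>M e\<in>lattice_edges. \<nu>) (translate a)"
    unfolding W by (intro distr_cong refl) (simp add: sets)
  also have "\<dots> = distr (\<Pi>\<^sub>M e\<in>lattice_edges. \<nu>) (\<Pi>\<^sub>M e\<in>lattice_edges. \<nu>)
      (\<lambda>w. \<lambda>e\<in>lattice_edges. w ((+) a ` e))"
    by (intro distr_cong refl) (auto simp: translate_def space_PiM PiE_def extensional_def
        fun_eq_iff image_translate_lattice_edges)
  also have "\<dots> = (\<Pi>\<^sub>M e\<in>lattice_edges. \<nu>)"
    using distr_PiM_reindex[of lattice_edges "\<lambda>_. \<nu>" "(`) ((+) a)" lattice_edges]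
    by (simp add: \<nu> inj_on_def inj_image_eq_iff image_translate_lattice_edges)
  finally show ?thesis using W by simp
qed

lemma AE_translate:
  assumes [measurable]: "Measurable.pred weight_space Q" and "AE \<omega> in M. Q (W \<omega>)"
  shows "AE \<omega> in M. Q (translate a (W \<omega>))"
proof -
  have "AE w in distr M weight_space W. Q w"
    using assms by (subst AE_distr_iff) auto
  then have "AE w in distr M weight_space (\<lambda>\<omega>. translate a (W \<omega>)). Q w"
    unfolding distr_translate .
  then show ?thesis by (subst (asm) AE_distr_iff) auto
qed

lemma expectation_translate:
  fixes h :: "_ \<Rightarrow> real"
  assumes [measurable]: "h \<in> borel_measurable weight_space"
  shows "expectation (\<lambda>\<omega>. h (translate a (W \<omega>))) = expectation (\<lambda>\<omega>. h (W \<omega>))"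
proof -
  have "expectation (\<lambda>\<omega>. h (translate a (W \<omega>))) = integral\<^sup>L (distr M weight_space (\<lambda>\<omega>. translate a (W \<omega>))) h"
    by (subst integral_distr) auto
  also have "\<dots> = expectation (\<lambda>\<omega>. h (W \<omega>))"
    unfolding distr_translate by (subst integral_distr) auto
  finally show ?thesis .
qed

text \<open>By \<open>inv\<close>, zeroing the first \<open>n\<close> weights of an enumeration does
  not affect \<open>Q\<close>. Hence for every \<open>n\<close> the event is determined by the
  weights from index \<open>n\<close> on, which makes it a tail event of an independent
  sequence.\<close>

lemma zero_one:
  assumes Q[measurable]: "Measurable.pred weight_space Q"
    and inv: "\<And>F w w'. finite F \<Longrightarrow> (\<And>e. e \<notin> F \<Longrightarrow> w e = w' e) \<Longrightarrow> Q w \<Longrightarrow> Q w'"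
  shows "(AE \<omega> in M. Q (W \<omega>)) \<or> (AE \<omega> in M. \<not> Q (W \<omega>))"
proof -
  define f :: "nat \<Rightarrow> (int ^ 'd) set" where "f = from_nat_into lattice_edges"
  have f: "bij_betw f UNIV lattice_edges"
    unfolding f_def by (rule bij_betw_from_nat_into[OF countable_lattice_edges infinite_lattice_edges])
  define A where "A n = {\<tau> (f n) -` B \<inter> space M | B. B \<in> sets borel}" for n
  define X where "X = {\<omega> \<in> space M. Q (W \<omega>)}"
  have f_in: "f n \<in> lattice_edges" for n using f by (auto simp: bij_betw_def)
  have A_sub: "A n \<subseteq> Pow (space M)" for n by (auto simp: A_def)
  have "prob X = 0 \<or> prob X = 1"
  proof (rule kolmogorov_0_1_law[where A = A])
    fix n show "sigma_algebra (space M) (A n)"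
      using sets.sigma_algebra_axioms[of "vimage_algebra (space M) (\<tau> (f n)) borel"]
      by (simp add: A_def sets_vimage_algebra2)
  next
    have ind: "indep_sets (\<lambda>e. {\<tau> e -` B \<inter> space M | B. B \<in> sets borel}) lattice_edges"
      using indep by (simp add: indep_vars_def2)
    show "indep_sets A UNIV"
    proof (rule indep_setsI)
      fix i show "A i \<subseteq> events"
        using measurable_sets[OF measurable_weight[OF f_in]] by (auto simp: A_def)
    next
      fix B J assume J: "J \<noteq> {}" "J \<subseteq> UNIV" "finite J" "\<forall>j\<in>J. B j \<in> A j"
      have inj: "inj_on f J" using f by (metis bij_betw_def inj_on_subset subset_UNIV)
      have *: "the_inv f (f j) = j" for j using f by (auto simp: bij_betw_def the_inv_f_f)
      have "prob (\<Inter>e\<in>f ` J. B (the_inv f e)) = (\<Prod>e\<in>f ` J. prob (B (the_inv f e)))"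
        by (rule indep_setsD[OF ind]) (use J f_in in \<open>auto simp: * A_def\<close>)
      then show "prob (\<Inter>j\<in>J. B j) = (\<Prod>j\<in>J. prob (B j))"
        by (simp add: * prod.reindex[OF inj] image_image)
    qed
  next
    show "X \<in> tail_events A" unfolding tail_events_def
    proof
      fix n
      define N where "N = sigma (space M) (\<Union> (A ` {n..}))"
      have sub: "\<Union> (A ` {n..}) \<subseteq> Pow (space M)" using A_sub by blast
      have space_N: "space N = space M" and sets_N: "sets N = sigma_sets (space M) (\<Union> (A ` {n..}))"
        using sub unfolding N_def by (auto simp: space_measure_of_conv)
      define F where "F = f ` {..<n}"
      \<comment> \<open>\<open>V\<close> is the environment with the first \<open>n\<close> weights
        erased; it is measurable with respect to the remaining ones.\<close>
      define V where "V \<omega> = (\<lambda>e\<in>lattice_edges. if e \<in> F then 0 else \<tau> e \<omega>)" for \<omega>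
      have "V \<in> measurable N weight_space"
        unfolding V_def
      proof (rule measurable_restrict)
        fix e :: "(int ^ 'd) set" assume "e \<in> lattice_edges"
        then obtain i where i: "e = f i" using f by (auto simp: bij_betw_def)
        show "(\<lambda>\<omega>. if e \<in> F then 0 else \<tau> e \<omega>) \<in> borel_measurable N"
        proof (cases "e \<in> F")
          case False
          then have "i \<ge> n" using i by (auto simp: F_def not_less[symmetric])
          then have "\<tau> e \<in> borel_measurable N"
            by (intro measurableI) (auto simp: space_N sets_N i A_def intro!: sigma_sets.Basic)
          then show ?thesis using False by simp
        qed simp
      qed
      then have "{\<omega> \<in> space N. Q (V \<omega>)} \<in> sets N" by measurable
      moreover have "{\<omega> \<in> space N. Q (V \<omega>)} = X"
      proof -
        have "finite F" by (simp add: F_def)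
        then have "Q (V \<omega>) \<longleftrightarrow> Q (W \<omega>)" for \<omega>
          using inv[of F "V \<omega>" "W \<omega>"] inv[of F "W \<omega>" "V \<omega>"] by (auto simp: V_def W_def)
        then show ?thesis by (simp add: X_def space_N)
      qed
      ultimately show "X \<in> sigma_sets (space M) (\<Union> (A ` {n..}))" by (simp add: sets_N)
    qed
  qed
  moreover have "X \<in> events" unfolding X_def by measurable
  ultimately show ?thesis
    unfolding X_def by (auto simp: prob_eq_0 prob_Collect_eq_1)
qed

end

section \<open>Existence of the time constant\<close>

lemma lattice_paths_edges: "p \<in> lattice_paths u v \<Longrightarrow> path_edges p \<subseteq> lattice_edges"
  by (simp add: lattice_paths_iff)

lemma axis_zero [simp]: "axis k 0 = 0"
  by (simp add: vec_eq_iff axis_def)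

lemma axis_add: "axis k (x + y :: int) = axis k x + axis k y"
  by (simp add: vec_eq_iff axis_def)

section \<open>Travel times minimized over finite sets of paths\<close>

definition path_min :: "(int ^ 'd::finite) list set \<Rightarrow> ((int ^ 'd) set \<Rightarrow> real) \<Rightarrow> real" where
  "path_min P w = Min ((\<lambda>p. path_time (\<lambda>e. \<bar>w e\<bar>) p) ` P)"

lemma measurable_path_min:
  assumes "finite P" "P \<subseteq> lattice_paths u v"
  shows "path_min P \<in> borel_measurable weight_space"
proof -
  have "(\<lambda>w. Min ((\<lambda>p. path_time (\<lambda>e. \<bar>w e\<bar>) p) ` P)) \<in> borel_measurable weight_space"
    using assms by (intro borel_measurable_Min measurable_path_time lattice_paths_edges[of _ u v]) auto
  then show ?thesis by (simp add: path_min_def[abs_def])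
qed

lemma edist_le_path_min:
  assumes "finite P" "P \<noteq> {}" "P \<subseteq> lattice_paths u v"
  shows "edist w u v \<le> path_min P w"
  unfolding path_min_def using assms by (auto intro: edist_le)

lemma path_min_nonneg:
  assumes "finite P" "P \<noteq> {}"
  shows "0 \<le> path_min P w"
  unfolding path_min_def using assms by (auto intro: path_time_nonneg)

lemma path_min_le: "finite P \<Longrightarrow> p \<in> P \<Longrightarrow> path_min P w \<le> path_time (\<lambda>e. \<bar>w e\<bar>) p"
  unfolding path_min_def by simp

text \<open>For finite \<open>P\<close> this is dependence on finitely many weights, the property
  that \<open>edist\<close> lacks.\<close>

lemma path_min_cong:
  assumes "\<And>e. e \<in> \<Union> (path_edges ` P) \<Longrightarrow> w e = w' e"
  shows "path_min P w = path_min P w'"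
proof -
  have "path_time (\<lambda>e. \<bar>w e\<bar>) p = path_time (\<lambda>e. \<bar>w' e\<bar>) p" if "p \<in> P" for p
    unfolding path_time_def using that by (intro sum.cong refl arg_cong[where f = abs] assms) auto
  then have "(\<lambda>p. path_time (\<lambda>e. \<bar>w e\<bar>) p) ` P = (\<lambda>p. path_time (\<lambda>e. \<bar>w' e\<bar>) p) ` P" by auto
  then show ?thesis by (simp add: path_min_def)
qed

lemma translate_zero [simp]: "translate 0 w = w"
  by (simp add: translate_def)

lemma translate_translate: "translate a (translate b w) = translate (b + a) w"
  by (simp add: translate_def image_image add.assoc)

text \<open>One vertex of an edge, shifted by the multiples of \<open>K\<close>, takes distinct
  positions and so meets the finite vertex set of \<open>F\<close> only finitely often. Thus a
  change of finitely many weights affects only finitely many blocks.\<close>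

lemma finite_translates_meeting:
  fixes k :: "'d::finite" and G F :: "(int ^ 'd) set set"
  assumes "finite F" "finite G" "G \<subseteq> lattice_edges" "F \<subseteq> lattice_edges" "0 < K"
  shows "finite {j::nat. \<exists>e\<in>G. (+) (axis k (int (j * K))) ` e \<in> F}"
proof -
  have "finite {j::nat. (+) (axis k (int (j * K))) ` e \<in> F}" if e: "e \<in> G" for e
  proof -
    obtain v where v: "v \<in> e" using e assms(3) by (auto elim: lattice_edgesE)
    have "finite (\<Union>F)"
      using assms(1,4) by (auto intro!: finite_Union elim!: lattice_edgesE)
    moreover have "inj (\<lambda>j::nat. axis k (int (j * K)) + v)"
      using \<open>0 < K\<close> by (auto simp: inj_on_def axis_eq_axis)
    ultimately have "finite ((\<lambda>j::nat. axis k (int (j * K)) + v) -` \<Union>F)" by (rule finite_vimageI)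
    moreover have "{j::nat. (+) (axis k (int (j * K))) ` e \<in> F} \<subseteq> (\<lambda>j::nat. axis k (int (j * K)) + v) -` \<Union>F"
      using v by auto
    ultimately show ?thesis by (rule rev_finite_subset)
  qed
  then have "finite (\<Union>e\<in>G. {j::nat. (+) (axis k (int (j * K))) ` e \<in> F})" using assms(2) by auto
  then show ?thesis by (rule rev_finite_subset) auto
qed

context percolation
begin

lemma weight_integrable: "e \<in> lattice_edges \<Longrightarrow> integrable M (\<lambda>\<omega>. \<bar>W \<omega> e\<bar>)"
proof -
  assume e: "e \<in> lattice_edges"
  note [measurable] = measurable_weight[OF e]
  have "integrable M (\<lambda>\<omega>. \<bar>\<tau> e \<omega>\<bar>)"
  proof (rule Bochner_Integration.integrable_bound[OF exp_integrable[OF e]])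
    have "\<bar>\<tau> e \<omega>\<bar> \<le> exp \<bar>\<tau> e \<omega>\<bar>" for \<omega>
      using exp_ge_add_one_self[of "\<bar>\<tau> e \<omega>\<bar>"] by linarith
    then show "AE \<omega> in M. norm \<bar>\<tau> e \<omega>\<bar> \<le> norm (exp \<bar>\<tau> e \<omega>\<bar>)" by simp
  qed measurable
  then show ?thesis using e by (simp add: W_def)
qed

lemma path_time_integrable:
  "p \<in> lattice_paths u v \<Longrightarrow> integrable M (\<lambda>\<omega>. path_time (\<lambda>e. \<bar>W \<omega> e\<bar>) p)"
  unfolding path_time_def by (intro Bochner_Integration.integrable_sum weight_integrable) (auto simp: lattice_paths_iff)

lemma edist_integrable: "integrable M (\<lambda>\<omega>. edist (W \<omega>) u v)"
proof -
  obtain p where p: "p \<in> lattice_paths u v" using lattice_paths_nonempty by blast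
  show ?thesis
    by (rule Bochner_Integration.integrable_bound[OF path_time_integrable[OF p]])
      (auto simp: edist_nonneg intro!: AE_I2 order_trans[OF edist_le[OF p]])
qed

lemma path_min_integrable:
  assumes "finite P" "P \<noteq> {}" "P \<subseteq> lattice_paths u v"
  shows "integrable M (\<lambda>\<omega>. path_min P (W \<omega>))"
proof -
  note [measurable] = measurable_path_min[OF assms(1,3)]
  obtain p where p: "p \<in> P" "p \<in> lattice_paths u v" using assms by blast
  show ?thesis
    by (rule Bochner_Integration.integrable_bound[OF path_time_integrable[OF p(2)]])
      (auto simp: path_min_nonneg assms intro!: AE_I2 order_trans[OF path_min_le[OF assms(1) p(1)]])
qed

text \<open>Along an enumeration of the countably many paths, the minima over initial segments tend
  to the infimum and are dominated by the time of the first path.\<close>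

lemma edist_approx_finite_paths:
  assumes "expectation (\<lambda>\<omega>. edist (W \<omega>) u v) < c"
  obtains P where "finite P" "P \<noteq> {}" "P \<subseteq> lattice_paths u v"
    "expectation (\<lambda>\<omega>. path_min P (W \<omega>)) < c"
proof -
  define f where "f = from_nat_into (lattice_paths u v)"
  have f: "range f = lattice_paths u v"
    unfolding f_def by (rule range_from_nat_into[OF lattice_paths_nonempty countableI_type])
  have sub: "f ` {..n} \<subseteq> lattice_paths u v" for n using f by auto
  note [measurable] = measurable_path_min[OF _ sub]
  have p0: "f 0 \<in> lattice_paths u v" using f by auto
  have "(\<lambda>n. expectation (\<lambda>\<omega>. path_min (f ` {..n}) (W \<omega>))) \<longlonglongrightarrow> expectation (\<lambda>\<omega>. edist (W \<omega>) u v)"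
  proof (rule integral_dominated_convergence[OF _ _ path_time_integrable[OF p0]])
    show "AE \<omega> in M. (\<lambda>n. path_min (f ` {..n}) (W \<omega>)) \<longlonglongrightarrow> edist (W \<omega>) u v"
    proof (rule AE_I2, rule LIMSEQ_I)
      fix \<omega> and \<epsilon> :: real assume "0 < \<epsilon>"
      then have "edist (W \<omega>) u v < edist (W \<omega>) u v + \<epsilon>" by simp
      then obtain p where p: "p \<in> lattice_paths u v" "path_time (\<lambda>e. \<bar>W \<omega> e\<bar>) p < edist (W \<omega>) u v + \<epsilon>"
        by (rule edist_less_path)
      then obtain i where i: "p = f i" using f by (metis rangeE)
      have "norm (path_min (f ` {..n}) (W \<omega>) - edist (W \<omega>) u v) < \<epsilon>" if "n \<ge> i" for n
        using edist_le_path_min[of "f ` {..n}" u v "W \<omega>"] sub[of n]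
          path_min_le[of "f ` {..n}" "f i" "W \<omega>"] that p i by (auto simp: abs_less_iff)
      then show "\<exists>n0. \<forall>n\<ge>n0. norm (path_min (f ` {..n}) (W \<omega>) - edist (W \<omega>) u v) < \<epsilon>" by blast
    qed
    show "AE \<omega> in M. norm (path_min (f ` {..n}) (W \<omega>)) \<le> path_time (\<lambda>e. \<bar>W \<omega> e\<bar>) (f 0)" for n
      by (auto intro!: AE_I2 path_min_le simp: path_min_nonneg)
  qed (auto intro: borel_measurable_integrable[OF edist_integrable])
  then have "eventually (\<lambda>n. expectation (\<lambda>\<omega>. path_min (f ` {..n}) (W \<omega>)) < c) sequentially"
    using assms by (simp add: order_tendsto_iff)
  then obtain n where "expectation (\<lambda>\<omega>. path_min (f ` {..n}) (W \<omega>)) < c"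
    by (auto simp: eventually_sequentially)
  with sub[of n] show thesis by (intro that[of "f ` {..n}"]) auto
qed

section \<open>Almost sure linear growth along an axis\<close>

definition mean_time :: "'d \<Rightarrow> nat \<Rightarrow> real" where
  "mean_time k n = expectation (\<lambda>\<omega>. edist (W \<omega>) 0 (axis k (int n)))"

text \<open>The limit of the mean times per unit length in the form of Fekete's lemma. As an infimum
  it bounds every mean time from below (lower bound on growth) and is nearly attained at some length
  (upper bound).\<close>

definition mu :: "'d \<Rightarrow> real" where
  "mu k = (INF n\<in>{1..}. mean_time k n / real n)"

lemma mean_time_nonneg: "0 \<le> mean_time k n"
  by (simp add: mean_time_def edist_nonneg)

lemma mu_le: "mu k * real n \<le> mean_time k n"
proof (cases "n = 0")
  case False
  then have "mu k \<le> mean_time k n / real n"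
    unfolding mu_def by (intro cINF_lower bdd_belowI[of _ 0]) (auto simp: mean_time_nonneg)
  then show ?thesis using False by (simp add: field_simps)
qed (simp add: mean_time_nonneg)

lemma mu_less:
  assumes "mu k < c"
  obtains n where "n \<ge> 1" "mean_time k n < c * real n"
proof -
  have "\<exists>x\<in>(\<lambda>n. mean_time k n / real n) ` {1..}. x < c"
    using assms unfolding mu_def by (intro cInf_lessD) auto
  then obtain n where "n \<ge> 1" "mean_time k n / real n < c" by auto
  then show thesis by (intro that[of n]) (auto simp: field_simps)
qed

text \<open>Suppose the distance falls short of \<open>c * n\<close> by arbitrarily large amounts
  almost surely. Then stretches with nonpositive \<open>D\<close> start at the origin almost surely,
  and the covering bound makes the mean time at most \<open>(c + \<delta>) * n\<close> plus a
  constant, against \<open>mu_le\<close>. The zero-one law turns the failure of this alternative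
  into the claim.\<close>

lemma edist_linear_lower:
  assumes c: "c < mu k"
  shows "AE \<omega> in M. \<exists>B::nat. \<forall>n. c * real n \<le> edist (W \<omega>) 0 (axis k (int n)) + real B"
proof (cases "0 \<le> c")
  case False
  then have "c * real n \<le> edist (W \<omega>) 0 (axis k (int n)) + real 0" for n \<omega>
    using edist_nonneg[of "W \<omega>" 0 "axis k (int n)"] by (simp add: mult_nonpos_nonneg order_trans[of _ 0])
  then show ?thesis by blast
next
  case True
  \<comment> \<open>Letting \<open>B\<close> be arbitrary makes \<open>Q\<close> invariant under finite changes of the weights.\<close>
  define Q where "Q w \<longleftrightarrow> (\<forall>B::nat. \<exists>n::nat. edist w 0 (axis k (int n)) + real B \<le> c * real n)"
    for w :: "(int ^ 'd) set \<Rightarrow> real"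
  have Q_meas: "Measurable.pred weight_space Q" unfolding Q_def by measurable
  have "(AE \<omega> in M. Q (W \<omega>)) \<or> (AE \<omega> in M. \<not> Q (W \<omega>))"
  proof (rule zero_one[OF Q_meas])
    fix F :: "(int ^ 'd) set set" and w w' :: "(int ^ 'd) set \<Rightarrow> real"
    assume F: "finite F" "\<And>e. e \<notin> F \<Longrightarrow> w e = w' e" and Q: "Q w"
    show "Q w'"
      unfolding Q_def
    proof
      fix B :: nat
      define B' where "B' = B + nat \<lceil>\<Sum>e\<in>F. \<bar>w' e\<bar>\<rceil>"
      obtain n where n: "edist w 0 (axis k (int n)) + real B' \<le> c * real n"
        using Q by (auto simp: Q_def)
      have "edist w' 0 (axis k (int n)) \<le> edist w 0 (axis k (int n)) + (\<Sum>e\<in>F. \<bar>w' e\<bar>)"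
        using F by (intro edist_change_finite) auto
      moreover have "real B + (\<Sum>e\<in>F. \<bar>w' e\<bar>) \<le> real B'" unfolding B'_def by linarith
      ultimately have "edist w' 0 (axis k (int n)) + real B \<le> c * real n" using n by linarith
      then show "\<exists>n. edist w' 0 (axis k (int n)) + real B \<le> c * real n" by blast
    qed
  qed
  moreover have "\<not> (AE \<omega> in M. Q (W \<omega>))"
  proof
    assume ae: "AE \<omega> in M. Q (W \<omega>)"
    define D where "D w i j = edist w (axis k (int i)) (axis k (int j)) - c * (real j - real i)"
      for w :: "(int ^ 'd) set \<Rightarrow> real" and i j
    \<comment> \<open>Half of the gap, so that \<open>c + \<delta>\<close> still lies below
      \<open>mu k\<close>.\<close>
    define \<delta> where "\<delta> = (mu k - c) / 2"
    have D_translate: "D w (j + i) (j + l) = D (translate (axis k (int j)) w) i l" for w i j l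
      unfolding D_def edist_translate by (simp add: axis_add)
    have D_meas [measurable]: "(\<lambda>w. D w i j) \<in> borel_measurable weight_space" for i j
      unfolding D_def by measurable
    have "\<exists>C. \<forall>n. expectation (\<lambda>\<omega>. D (W \<omega>) 0 n) \<le> \<delta> * real n + C"
    proof (rule expectation_cover[where X = "\<lambda>i j \<omega>. D (W \<omega>) i j"
          and b = "\<lambda>j \<omega>. edist (translate (axis k (int j)) (W \<omega>)) 0 (axis k 1)"])
      show "D (W \<omega>) i l \<le> D (W \<omega>) i j + D (W \<omega>) j l" for i j l \<omega>
        using edist_triangle[of "W \<omega>" "axis k (int i)" "axis k (int l)" "axis k (int j)"]
        by (simp add: D_def algebra_simps)
      \<comment> \<open>Here \<open>0 \<le> c\<close> matters: subtracting \<open>c\<close> can only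
        lower the cost of a step.\<close>
      show "D (W \<omega>) j (Suc j) \<le> edist (translate (axis k (int j)) (W \<omega>)) 0 (axis k 1)" for j \<omega>
        using D_translate[of "W \<omega>" j 0 1] \<open>0 \<le> c\<close> by (simp add: D_def)
      show "integrable M (\<lambda>\<omega>. D (W \<omega>) i j)" for i j
        unfolding D_def by (intro Bochner_Integration.integrable_diff edist_integrable) auto
      show "integrable M (\<lambda>\<omega>. edist (translate (axis k (int j)) (W \<omega>)) 0 (axis k 1))" for j
        unfolding edist_translate by (rule edist_integrable)
      show "expectation (\<lambda>\<omega>. edist (translate (axis k (int j)) (W \<omega>)) 0 (axis k 1)) =
          expectation (\<lambda>\<omega>. edist (translate (axis k (int 0)) (W \<omega>)) 0 (axis k 1))" for j
        using expectation_translate[of "\<lambda>w. edist w 0 (axis k 1)"] by simp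
      show "expectation (\<lambda>\<omega>. if \<exists>N\<in>{1..K}. D (W \<omega>) j (j + N) \<le> 0 then 0
            else edist (translate (axis k (int j)) (W \<omega>)) 0 (axis k 1)) =
          expectation (\<lambda>\<omega>. if \<exists>N\<in>{1..K}. D (W \<omega>) 0 N \<le> 0 then 0
            else edist (translate (axis k (int 0)) (W \<omega>)) 0 (axis k 1))" for K j
      proof -
        define h where "h w = (if \<exists>N\<in>{1..K}. D w 0 N \<le> 0 then 0 else edist w 0 (axis k 1))"
          for w :: "(int ^ 'd) set \<Rightarrow> real"
        have "h \<in> borel_measurable weight_space" unfolding h_def by measurable
        from expectation_translate[OF this, of "axis k (int j)"] show ?thesis
          using D_translate[of _ j 0] by (simp add: h_def cong: if_cong)
      qed
      show "AE \<omega> in M. \<exists>N\<ge>1. D (W \<omega>) 0 N \<le> 0"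
        using ae
      proof eventually_elim
        case (elim \<omega>)
        \<comment> \<open>The surplus 1 rules out \<open>n = 0\<close>, for which the inequality
          would read \<open>1 \<le> 0\<close>.\<close>
        then obtain n where n: "edist (W \<omega>) 0 (axis k (int n)) + real 1 \<le> c * real n"
          unfolding Q_def by blast
        then have "n \<noteq> 0" by (intro notI) simp
        then show ?case using n by (intro exI[of _ n]) (auto simp: D_def)
      qed
      show "0 < \<delta>" using c by (simp add: \<delta>_def)
    qed (auto simp: D_def edist_nonneg)
    then obtain C where C: "\<And>n. expectation (\<lambda>\<omega>. D (W \<omega>) 0 n) \<le> \<delta> * real n + C" by blast
    have D_mean: "expectation (\<lambda>\<omega>. D (W \<omega>) 0 n) = mean_time k n - c * real n" for n
      by (simp add: D_def mean_time_def edist_integrable prob_space)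
    have "\<delta> * real n \<le> C" for n
      using C[of n] mu_le[of k n] by (simp add: \<delta>_def D_mean field_simps)
    moreover obtain n where "C < real n * \<delta>"
      using ex_less_of_nat_mult[of \<delta> C] c by (auto simp: \<delta>_def)
    ultimately show False by (metis mult.commute not_less)
  qed
  ultimately have "AE \<omega> in M. \<not> Q (W \<omega>)" by blast
  then show ?thesis
  proof eventually_elim
    case (elim \<omega>)
    then show ?case unfolding Q_def by (meson less_imp_le not_le)
  qed
qed

text \<open>The covering bound needs subadditivity, but \<open>c * n\<close> minus the distance is
  superadditive. The distance is therefore replaced by the larger additive quantity
  \<open>S\<close>, a sum over blocks of length \<open>K\<close> of minima over translates of one
  finite path set \<open>P\<close>, chosen so that the mean per block is still below
  \<open>c * K\<close>. Then \<open>c' * n\<close> minus \<open>S\<close> is additive, and the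
  argument of the lower bound applies to it.\<close>

lemma edist_linear_upper:
  assumes c: "mu k < c"
  shows "AE \<omega> in M. \<exists>B::nat. \<forall>n. edist (W \<omega>) 0 (axis k (int n)) \<le> c * real n + real B"
proof -
  obtain K where K: "K \<ge> 1" "mean_time k K < c * real K" using mu_less[OF c] .
  define c' where "c' = c * real K"
  have "expectation (\<lambda>\<omega>. edist (W \<omega>) 0 (axis k (int K))) < c'"
    using K by (simp add: mean_time_def c'_def)
  then obtain P where P: "finite P" "P \<noteq> {}" "P \<subseteq> lattice_paths 0 (axis k (int K))"
    "expectation (\<lambda>\<omega>. path_min P (W \<omega>)) < c'"
    by (rule edist_approx_finite_paths)
  have "0 < c'" using K mean_time_nonneg[of k K] by (simp add: c'_def)
  have c0: "0 \<le> c" using K mean_time_nonneg[of k K] by (smt (verit) mult_nonneg_nonneg mult_neg_pos of_nat_0_le_iff zero_less_mult_iff)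
  have [measurable]: "path_min P \<in> borel_measurable weight_space" by (rule measurable_path_min[OF P(1,3)])
  define v where "v j = axis k (int (j * K))" for j
  have v_add: "v (i + j) = v i + v j" for i j by (simp add: v_def distrib_right axis_add)
  have v0 [simp]: "v 0 = 0" by (simp add: v_def)
  define S where "S w n = (\<Sum>j<n. path_min P (translate (v j) w))"
    for w :: "(int ^ 'd) set \<Rightarrow> real" and n :: nat
  have S_meas [measurable]: "(\<lambda>w. S w n) \<in> borel_measurable weight_space" for n
    unfolding S_def by measurable
  \<comment> \<open>As in the lower bound, quantifying over all \<open>B\<close> absorbs the effect
    of finitely many weights.\<close>
  define Q where "Q w \<longleftrightarrow> (\<forall>B::nat. \<exists>n::nat. c' * real n + real B \<le> S w n)"
    for w :: "(int ^ 'd) set \<Rightarrow> real"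
  have Q_meas [measurable]: "Measurable.pred weight_space Q" unfolding Q_def by measurable
  have edist_S: "edist w 0 (v n) \<le> S w n" for w n
  proof (induction n)
    case (Suc n)
    have "edist w 0 (v (Suc n)) \<le> edist w 0 (v n) + edist w (v n) (v (Suc n))" by (rule edist_triangle)
    also have "edist w (v n) (v (Suc n)) = edist (translate (v n) w) 0 (axis k (int K))"
      using v_add[of n 1] by (simp add: edist_translate v_def)
    also have "\<dots> \<le> path_min P (translate (v n) w)" by (rule edist_le_path_min[OF P(1-3)])
    finally show ?case using Suc by (simp add: S_def)
  qed (simp add: S_def)
  have "(AE \<omega> in M. Q (W \<omega>)) \<or> (AE \<omega> in M. \<not> Q (W \<omega>))"
  proof (rule zero_one[OF Q_meas])
    fix F :: "(int ^ 'd) set set" and w w' :: "(int ^ 'd) set \<Rightarrow> real"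
    assume F: "finite F" "\<And>e. e \<notin> F \<Longrightarrow> w e = w' e" and Q: "Q w"
    define G where "G = \<Union> (path_edges ` P)"
    have G: "finite G" "G \<subseteq> lattice_edges" using P(1,3) lattice_paths_edges[of _ 0 "axis k (int K)"] by (auto simp: G_def)
    \<comment> \<open>The blocks whose paths touch a changed weight. \<open>F\<close> may contain
      sets that are not edges; the intersection provides the hypothesis of
      \<open>finite_translates_meeting\<close>.\<close>
    define J where "J = {j::nat. \<exists>e\<in>G. (+) (v j) ` e \<in> F \<inter> lattice_edges}"
    have "finite J"
      unfolding J_def v_def using F(1) G K(1) by (intro finite_translates_meeting) auto
    have outside: "path_min P (translate (v j) w) = path_min P (translate (v j) w')" if "j \<notin> J" for j
    proof (rule path_min_cong)
      fix e assume "e \<in> \<Union> (path_edges ` P)"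
      then have "e \<in> G" by (simp add: G_def)
      then have "(+) (v j) ` e \<in> lattice_edges" using G by (auto simp: image_translate_lattice_edges)
      then show "translate (v j) w e = translate (v j) w' e"
        using that \<open>e \<in> G\<close> by (auto simp: translate_def J_def intro!: F(2))
    qed
    have S_le: "S w n \<le> S w' n + (\<Sum>j\<in>J. path_min P (translate (v j) w))" for n
    proof -
      have "S w n = (\<Sum>j\<in>{..<n} - J. path_min P (translate (v j) w)) + (\<Sum>j\<in>{..<n} \<inter> J. path_min P (translate (v j) w))"
        unfolding S_def by (subst sum.union_disjoint[symmetric]) (auto intro!: sum.cong)
      moreover have "(\<Sum>j\<in>{..<n} \<inter> J. path_min P (translate (v j) w)) \<le> (\<Sum>j\<in>J. path_min P (translate (v j) w))"
        using \<open>finite J\<close> by (intro sum_mono2) (auto simp: path_min_nonneg P)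
      moreover have "(\<Sum>j\<in>{..<n} - J. path_min P (translate (v j) w)) = (\<Sum>j\<in>{..<n} - J. path_min P (translate (v j) w'))"
        using outside by (intro sum.cong) auto
      moreover have "\<dots> \<le> S w' n"
        unfolding S_def by (intro sum_mono2) (auto simp: path_min_nonneg P)
      ultimately show ?thesis by linarith
    qed
    show "Q w'"
      unfolding Q_def
    proof
      fix B :: nat
      define B' where "B' = B + nat \<lceil>\<Sum>j\<in>J. path_min P (translate (v j) w)\<rceil>"
      obtain n where n: "c' * real n + real B' \<le> S w n" using Q by (auto simp: Q_def)
      moreover have "real B + (\<Sum>j\<in>J. path_min P (translate (v j) w)) \<le> real B'" unfolding B'_def by linarith
      ultimately have "c' * real n + real B \<le> S w' n" using S_le[of n] by linarith
      then show "\<exists>n. c' * real n + real B \<le> S w' n" by blast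
    qed
  qed
  moreover have "\<not> (AE \<omega> in M. Q (W \<omega>))"
  proof
    assume ae: "AE \<omega> in M. Q (W \<omega>)"
    define E where "E = expectation (\<lambda>\<omega>. path_min P (W \<omega>))"
    define D where "D w i j = c' * (real j - real i) - (\<Sum>l\<in>{i..<j}. path_min P (translate (v l) w))"
      for w :: "(int ^ 'd) set \<Rightarrow> real" and i j
    \<comment> \<open>The mean of \<open>D\<close> grows with slope \<open>c' - E\<close>, twice the
      slope \<delta> that the covering bound would allow.\<close>
    define \<delta> where "\<delta> = (c' - E) / 2"
    have D_translate: "D w j (j + l) = D (translate (v j) w) 0 l" for w j l
    proof -
      have "(\<Sum>i\<in>{j..<j + l}. path_min P (translate (v i) w)) = (\<Sum>i\<in>{0..<l}. path_min P (translate (v (i + j)) w))"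
        using sum.shift_bounds_nat_ivl[of "\<lambda>i. path_min P (translate (v i) w)" 0 j l] by (simp add: add.commute)
      then show ?thesis
        by (simp add: D_def translate_translate v_add add.commute)
    qed
    have D_meas [measurable]: "(\<lambda>w. D w i j) \<in> borel_measurable weight_space" for i j
      unfolding D_def by measurable
    have int: "integrable M (\<lambda>\<omega>. path_min P (translate a (W \<omega>)))" for a
    proof -
      have "integrable (distr M weight_space W) (path_min P)"
        using path_min_integrable[OF P(1-3)] by (subst integrable_distr_eq) auto
      then have "integrable (distr M weight_space (\<lambda>\<omega>. translate a (W \<omega>))) (path_min P)"
        unfolding distr_translate .
      then show ?thesis by (subst (asm) integrable_distr_eq) auto
    qed
    have "\<exists>C. \<forall>n. expectation (\<lambda>\<omega>. D (W \<omega>) 0 n) \<le> \<delta> * real n + C"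
    proof (rule expectation_cover[where X = "\<lambda>i j \<omega>. D (W \<omega>) i j" and b = "\<lambda>j \<omega>. c'"])
      show "D (W \<omega>) i l \<le> D (W \<omega>) i j + D (W \<omega>) j l" if "i \<le> j" "j \<le> l" for i j l \<omega>
        using sum.atLeastLessThan_concat[OF that, of "\<lambda>i. path_min P (translate (v i) (W \<omega>))"]
        by (simp add: D_def algebra_simps)
      show "D (W \<omega>) j (Suc j) \<le> c'" for j \<omega> by (simp add: D_def path_min_nonneg P)
      show "integrable M (\<lambda>\<omega>. D (W \<omega>) i j)" for i j
        unfolding D_def by (intro Bochner_Integration.integrable_diff Bochner_Integration.integrable_sum int) auto
      show "expectation (\<lambda>\<omega>. if \<exists>N\<in>{1..K}. D (W \<omega>) j (j + N) \<le> 0 then 0 else c') =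
          expectation (\<lambda>\<omega>. if \<exists>N\<in>{1..K}. D (W \<omega>) 0 N \<le> 0 then 0 else c')" for K j
      proof -
        define h where "h w = (if \<exists>N\<in>{1..K}. D w 0 N \<le> 0 then 0 else c')"
          for w :: "(int ^ 'd) set \<Rightarrow> real"
        have "h \<in> borel_measurable weight_space" unfolding h_def by measurable
        from expectation_translate[OF this, of "v j"]
        show ?thesis using D_translate[of _ j] by (simp add: h_def)
      qed
      show "AE \<omega> in M. \<exists>N\<ge>1. D (W \<omega>) 0 N \<le> 0"
        using ae
      proof eventually_elim
        case (elim \<omega>)
        then obtain n where n: "c' * real n + real 1 \<le> S (W \<omega>) n" unfolding Q_def by blast
        then have "n \<noteq> 0" by (intro notI) (simp add: S_def)
        then show ?case using n by (intro exI[of _ n]) (auto simp: D_def S_def atLeast0LessThan)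
      qed
      show "0 < \<delta>" using P(4) by (simp add: \<delta>_def E_def)
    qed (use \<open>0 < c'\<close> in \<open>auto simp: D_def\<close>)
    then obtain C where C: "\<And>n. expectation (\<lambda>\<omega>. D (W \<omega>) 0 n) \<le> \<delta> * real n + C" by blast
    have D_mean: "expectation (\<lambda>\<omega>. D (W \<omega>) 0 n) = c' * real n - E * real n" for n
      using expectation_translate[of "path_min P"]
      by (simp add: D_def int prob_space E_def Bochner_Integration.integrable_sum)
    have "\<delta> * real n \<le> C" for n
      using C[of n] by (simp add: \<delta>_def D_mean field_simps)
    moreover obtain n where "C < real n * \<delta>"
      using ex_less_of_nat_mult[of \<delta> C] P(4) by (auto simp: \<delta>_def E_def)
    ultimately show False by (metis mult.commute not_less)
  qed
  ultimately have "AE \<omega> in M. \<not> Q (W \<omega>)" by blast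
  \<comment> \<open>Block sums from the origin reach only multiples of \<open>K\<close>. A general
    \<open>n\<close> is reached from its residue modulo \<open>K\<close>, so the bound is needed at
    shifted starting points too.\<close>
  then have "AE \<omega> in M. \<not> Q (translate (axis k (int r)) (W \<omega>))" for r :: nat
    by (rule AE_translate[rotated]) measurable
  then have "AE \<omega> in M. \<forall>r::nat. \<not> Q (translate (axis k (int r)) (W \<omega>))"
    by (simp add: AE_all_countable)
  then show ?thesis
  proof eventually_elim
    case (elim \<omega>)
    have "\<forall>r::nat. \<exists>B::nat. \<forall>n. S (translate (axis k (int r)) (W \<omega>)) n \<le> c' * real n + real B"
      using elim unfolding Q_def by (meson less_imp_le not_le)
    then obtain B :: "nat \<Rightarrow> nat"
      where B: "\<And>r n. S (translate (axis k (int r)) (W \<omega>)) n \<le> c' * real n + real (B r)"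
      by metis
    \<comment> \<open>Cost of getting from 0 to the residue \<open>r\<close> plus the additive
      constant of the bound that starts there; summing over all residues gives one constant for
      every \<open>n\<close>.\<close>
    define A where "A r = nat \<lceil>edist (W \<omega>) 0 (axis k (int r))\<rceil> + B r" for r
    have "edist (W \<omega>) 0 (axis k (int n)) \<le> c * real n + real (\<Sum>r<K. A r)" for n
    proof -
      define r q where "r = n mod K" and "q = n div K"
      have n: "n = r + q * K" by (simp add: r_def q_def)
      have "r < K" using K by (simp add: r_def)
      have "axis k (int n) = axis k (int r) + v q" by (simp add: n v_def axis_add)
      then have "edist (W \<omega>) 0 (axis k (int n)) \<le>
          edist (W \<omega>) 0 (axis k (int r)) + edist (translate (axis k (int r)) (W \<omega>)) 0 (v q)"
        using edist_triangle[of "W \<omega>" 0 "axis k (int n)" "axis k (int r)"] by (simp add: edist_translate)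
      also have "edist (translate (axis k (int r)) (W \<omega>)) 0 (v q) \<le> c' * real q + real (B r)"
        using edist_S[of "translate (axis k (int r)) (W \<omega>)" q] B[of r q] by linarith
      also have "c' * real q \<le> c * real n"
        using c0 by (simp add: c'_def n algebra_simps mult_left_mono)
      also have "edist (W \<omega>) 0 (axis k (int r)) \<le> real (nat \<lceil>edist (W \<omega>) 0 (axis k (int r))\<rceil>)" by linarith
      finally have "edist (W \<omega>) 0 (axis k (int n)) \<le> c * real n + real (A r)" by (simp add: A_def)
      moreover have "A r \<le> (\<Sum>r<K. A r)" using \<open>r < K\<close> by (intro member_le_sum) auto
      ultimately show ?thesis by (smt (verit) of_nat_mono)
    qed
    then show ?case by blast
  qed
qed

text \<open>The exceptional null sets of the linear bounds depend on the slope, so the slopes are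
  restricted to the countable family \<open>mu k\<close> plus or minus
  \<open>1 / real (Suc m)\<close>.\<close>

lemma edist_tendsto:
  "AE \<omega> in M. (\<lambda>n. edist (W \<omega>) 0 (axis k (int n)) / real n) \<longlonglongrightarrow> mu k"
proof -
  have "AE \<omega> in M. \<forall>m::nat. \<exists>B::nat. \<forall>n. (mu k - 1 / real (Suc m)) * real n \<le> edist (W \<omega>) 0 (axis k (int n)) + real B"
    unfolding AE_all_countable by (intro allI edist_linear_lower) simp
  moreover have "AE \<omega> in M. \<forall>m::nat. \<exists>B::nat. \<forall>n. edist (W \<omega>) 0 (axis k (int n)) \<le> (mu k + 1 / real (Suc m)) * real n + real B"
    unfolding AE_all_countable by (intro allI edist_linear_upper) simp
  ultimately show ?thesis
  proof eventually_elim
    case (elim \<omega>)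
    show ?case
    proof (rule LIMSEQ_I)
      fix \<epsilon> :: real assume \<epsilon>: "0 < \<epsilon>"
      obtain m where m: "1 / real (Suc m) < \<epsilon> / 2"
        using nat_approx_posE[of "\<epsilon> / 2"] \<epsilon> by auto
      obtain B B' :: nat where
        B: "\<And>n. (mu k - 1 / real (Suc m)) * real n \<le> edist (W \<omega>) 0 (axis k (int n)) + real B"
        and B': "\<And>n. edist (W \<omega>) 0 (axis k (int n)) \<le> (mu k + 1 / real (Suc m)) * real n + real B'"
        using elim by meson
      have lim: "(\<lambda>n. real (B + B') / real n) \<longlonglongrightarrow> 0" by (rule lim_const_over_n)
      have "eventually (\<lambda>n. real (B + B') / real n < \<epsilon> / 2) sequentially"
        using order_tendstoD(2)[OF lim, of "\<epsilon> / 2"] \<epsilon> by simp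
      then have "eventually (\<lambda>n. norm (edist (W \<omega>) 0 (axis k (int n)) / real n - mu k) < \<epsilon>) sequentially"
        using eventually_gt_at_top[of 0]
      proof eventually_elim
        case (elim n)
        let ?d = "edist (W \<omega>) 0 (axis k (int n))"
        have 1: "mu k - 1 / real (Suc m) \<le> ?d / real n + real B / real n"
          using B[of n] elim(2) by (simp add: add_divide_distrib[symmetric] pos_le_divide_eq)
        have 2: "?d / real n \<le> mu k + 1 / real (Suc m) + real B' / real n"
          using B'[of n] elim(2) by (simp add: divide_le_eq distrib_right)
        have 3: "real (B + B') / real n = real B / real n + real B' / real n"
          by (simp add: add_divide_distrib)
        have 4: "0 \<le> real B / real n" "0 \<le> real B' / real n" by auto
        from 1 2 3 4 m elim(1) show ?case unfolding real_norm_def by arith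
      qed
      then show "\<exists>n0. \<forall>n\<ge>n0. norm (edist (W \<omega>) 0 (axis k (int n)) / real n - mu k) < \<epsilon>"
        by (simp add: eventually_sequentially)
    qed
  qed
qed

end

text \<open>Splitting by the integer part bounds \<open>exp X\<close> by the sum of
  \<open>exp (n + 1)\<close> over the events \<open>n \<le> X\<close>. Since \<open>1 < r\<close>,
  the tail beats \<open>exp (n + 1)\<close>, and the terms are eventually below those of a geometric
  series.\<close>

lemma (in prob_space) exp_integrable_of_tail:
  fixes X :: "'a \<Rightarrow> real"
  assumes [measurable]: "X \<in> borel_measurable M" and nonneg: "\<And>\<omega>. \<omega> \<in> space M \<Longrightarrow> 0 \<le> X \<omega>"
    and "1 < r" "0 < \<alpha>" "0 < \<beta>"
    and tail: "\<And>t. 0 \<le> t \<Longrightarrow> \<P>(\<omega> in M. t \<le> X \<omega>) \<le> \<beta> * exp (- \<alpha> * t powr r)"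
  shows "integrable M (\<lambda>\<omega>. exp (X \<omega>))"
proof (rule integrableI_bounded)
  define a where "a n = exp (real n + 1) * (\<beta> * exp (- \<alpha> * real n powr r))" for n :: nat
  have "eventually (\<lambda>n. norm (a n) \<le> exp (- 1) ^ n) sequentially"
  proof -
    have "eventually (\<lambda>n. exp (real n + 1) * (\<beta> * exp (- \<alpha> * real n powr r)) \<le> exp (- real n)) sequentially"
      using assms(3-5) by real_asymp
    then show ?thesis
      by eventually_elim (use \<open>0 < \<beta>\<close> in \<open>simp add: a_def abs_mult exp_of_nat_mult[symmetric]\<close>)
  qed
  then have "summable a"
    by (rule summable_comparison_test_ev) (simp add: summable_geometric)
  have "(\<integral>\<^sup>+\<omega>. ennreal (norm (exp (X \<omega>))) \<partial>M)
      \<le> (\<integral>\<^sup>+\<omega>. (\<Sum>n. ennreal (exp (real n + 1)) * indicator {\<omega>\<in>space M. real n \<le> X \<omega>} \<omega>) \<partial>M)"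
  proof (rule nn_integral_mono)
    fix \<omega> assume \<omega>: "\<omega> \<in> space M"
    define n where "n = nat \<lfloor>X \<omega>\<rfloor>"
    have n: "real n \<le> X \<omega>" "X \<omega> \<le> real n + 1" using nonneg[OF \<omega>] unfolding n_def by linarith+
    have "ennreal (norm (exp (X \<omega>))) \<le> ennreal (exp (real n + 1)) * indicator {\<omega>\<in>space M. real n \<le> X \<omega>} \<omega>"
      using n \<omega> by (simp add: ennreal_leI)
    also have "\<dots> = (\<Sum>n\<in>{n}. ennreal (exp (real n + 1)) * indicator {\<omega>\<in>space M. real n \<le> X \<omega>} \<omega>)"
      by (simp only: sum.insert finite.emptyI empty_iff not_False_eq_True sum.empty add_0_right)
    also have "\<dots> \<le> (\<Sum>n. ennreal (exp (real n + 1)) * indicator {\<omega>\<in>space M. real n \<le> X \<omega>} \<omega>)"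
      by (rule sum_le_suminf[OF summableI]) auto
    finally show "ennreal (norm (exp (X \<omega>)))
        \<le> (\<Sum>n. ennreal (exp (real n + 1)) * indicator {\<omega>\<in>space M. real n \<le> X \<omega>} \<omega>)" .
  qed
  also have "\<dots> = (\<Sum>n. ennreal (exp (real n + 1)) * emeasure M {\<omega>\<in>space M. real n \<le> X \<omega>})"
    by (subst nn_integral_suminf) (auto simp: nn_integral_cmult_indicator)
  also have "\<dots> \<le> (\<Sum>n. ennreal (a n))"
  proof (rule suminf_le)
    fix n
    have "ennreal (exp (real n + 1)) * emeasure M {\<omega>\<in>space M. real n \<le> X \<omega>}
        = ennreal (exp (real n + 1) * prob {\<omega>\<in>space M. real n \<le> X \<omega>})"
      by (simp add: emeasure_eq_measure ennreal_mult)
    also have "\<dots> \<le> ennreal (a n)"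
      unfolding a_def using tail[of "real n"] by (intro ennreal_leI mult_left_mono) auto
    finally show "ennreal (exp (real n + 1)) * emeasure M {\<omega>\<in>space M. real n \<le> X \<omega>} \<le> ennreal (a n)" .
  qed auto
  also have "\<dots> = ennreal (\<Sum>n. a n)"
    using \<open>0 < \<beta>\<close> by (intro suminf_ennreal2 \<open>summable a\<close>) (simp add: a_def)
  also have "\<dots> < \<infinity>" by simp
  finally show "(\<integral>\<^sup>+\<omega>. ennreal (norm (exp (X \<omega>))) \<partial>M) < \<infinity>" .
qed measurable

section \<open>Identification of the time constant\<close>

lemma floor_vec_axis: "floor_vec (t *\<^sub>R axis k 1) = axis k \<lfloor>t\<rfloor>"
  by (simp add: floor_vec_def axis_def vec_eq_iff)

lemma floor_vec_zero: "floor_vec 0 = 0"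
  by (simp add: floor_vec_def vec_eq_iff)

context percolation
begin

lemma passage_time_eq:
  assumes "\<And>e. e \<in> lattice_edges \<Longrightarrow> 0 \<le> \<tau> e \<omega>"
  shows "passage_time (\<lambda>e. \<tau> e \<omega>) 0 (t *\<^sub>R axis k 1) = edist (W \<omega>) 0 (axis k \<lfloor>t\<rfloor>)"
proof -
  have "passage_time (\<lambda>e. \<tau> e \<omega>) 0 (t *\<^sub>R axis k 1)
      = edist (W \<omega>) (floor_vec 0) (floor_vec (t *\<^sub>R axis k 1))"
    by (rule passage_time_eq_edist) (simp_all add: W_def assms)
  then show ?thesis unfolding floor_vec_axis floor_vec_zero .
qed

text \<open>Real times reduce to integer ones because the floor of \<open>t\<close> divided by
  \<open>t\<close> tends to 1. Two almost sure limits agree at some common sample point, which gives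
  the uniqueness that the definite description requires.\<close>

lemma time_constant_eq:
  assumes nonneg: "\<And>e \<omega>. e \<in> lattice_edges \<Longrightarrow> \<omega> \<in> space M \<Longrightarrow> 0 \<le> \<tau> e \<omega>"
  shows "time_constant M \<tau> (axis k 1) = mu k"
proof -
  have lim: "AE \<omega> in M. ((\<lambda>t::real. passage_time (\<lambda>e. \<tau> e \<omega>) 0 (t *\<^sub>R axis k 1) / t) \<longlongrightarrow> mu k) at_top"
    using edist_tendsto[of k] AE_space
  proof eventually_elim
    case (elim \<omega>)
    define f where "f n = edist (W \<omega>) 0 (axis k (int n)) / real n" for n
    have floor: "filterlim (\<lambda>t::real. nat \<lfloor>t\<rfloor>) sequentially at_top"
      by (rule filterlim_compose[OF filterlim_nat_sequentially filterlim_floor_sequentially])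
    have "((\<lambda>t::real. f (nat \<lfloor>t\<rfloor>)) \<longlongrightarrow> mu k) at_top"
      using filterlim_compose[OF _ floor] elim(1) unfolding f_def by blast
    moreover have "((\<lambda>t::real. real_of_int \<lfloor>t\<rfloor> / t) \<longlongrightarrow> 1) at_top" by real_asymp
    ultimately have "((\<lambda>t::real. f (nat \<lfloor>t\<rfloor>) * (real_of_int \<lfloor>t\<rfloor> / t)) \<longlongrightarrow> mu k * 1) at_top"
      by (rule tendsto_mult)
    then have "((\<lambda>t::real. f (nat \<lfloor>t\<rfloor>) * (real_of_int \<lfloor>t\<rfloor> / t)) \<longlongrightarrow> mu k) at_top" by simp
    then show ?case
    proof (rule Lim_transform_eventually)
      show "eventually (\<lambda>t. f (nat \<lfloor>t\<rfloor>) * (real_of_int \<lfloor>t\<rfloor> / t) =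
          passage_time (\<lambda>e. \<tau> e \<omega>) 0 (t *\<^sub>R axis k 1) / t) at_top"
        using eventually_ge_at_top[of "1::real"]
      proof eventually_elim
        case (elim t)
        then have "\<lfloor>t\<rfloor> \<ge> 1" by simp
        then show ?case using passage_time_eq[OF nonneg] \<open>\<omega> \<in> space M\<close> by (simp add: f_def)
      qed
    qed
  qed
  show ?thesis
    unfolding time_constant_def
  proof (rule the_equality)
    show "AE \<omega> in M. ((\<lambda>t::real. passage_time (\<lambda>e. \<tau> e \<omega>) 0 (t *\<^sub>R axis k 1) / t) \<longlongrightarrow> mu k) at_top"
      by (fact lim)
  next
    fix m
    assume "AE \<omega> in M. ((\<lambda>t::real. passage_time (\<lambda>e. \<tau> e \<omega>) 0 (t *\<^sub>R axis k 1) / t) \<longlongrightarrow> m) at_top"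
    with lim have "AE \<omega> in M. m = mu k"
      by eventually_elim (rule tendsto_unique[OF trivial_limit_at_top_linorder])
    then show "m = mu k" by simp
  qed
qed

section \<open>Upper tail of the passage time\<close>

lemma expectation_exp_weight:
  assumes "e \<in> lattice_edges" "f \<in> lattice_edges"
  shows "expectation (\<lambda>\<omega>. exp \<bar>\<tau> e \<omega>\<bar>) = expectation (\<lambda>\<omega>. exp \<bar>\<tau> f \<omega>\<bar>)"
proof -
  have eq: "expectation (\<lambda>\<omega>. exp \<bar>\<tau> e \<omega>\<bar>) = integral\<^sup>L (distr M borel (\<tau> e)) (\<lambda>x. exp \<bar>x\<bar>)" if "e \<in> lattice_edges" for e
    using measurable_weight[OF that] by (subst integral_distr) auto
  show ?thesis unfolding eq[OF assms(1)] eq[OF assms(2)] ident[OF assms] ..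
qed

lemma mgf_edges:
  assumes "finite G" "G \<subseteq> lattice_edges" "f \<in> lattice_edges"
  shows "integrable M (\<lambda>\<omega>. exp (\<Sum>e\<in>G. \<bar>\<tau> e \<omega>\<bar>))" (is ?int)
    and "expectation (\<lambda>\<omega>. exp (\<Sum>e\<in>G. \<bar>\<tau> e \<omega>\<bar>)) = expectation (\<lambda>\<omega>. exp \<bar>\<tau> f \<omega>\<bar>) ^ card G" (is ?eq)
proof -
  have ind: "indep_vars (\<lambda>_. borel) (\<lambda>e \<omega>. exp \<bar>\<tau> e \<omega>\<bar>) G"
    using indep_vars_compose2[OF indep_vars_subset[OF indep assms(2)], of "\<lambda>_ x. exp \<bar>x\<bar>" "\<lambda>_. borel"] by simp
  have int: "integrable M (\<lambda>\<omega>. exp \<bar>\<tau> e \<omega>\<bar>)" if "e \<in> G" for e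
    using exp_integrable assms(2) that by auto
  show ?int using indep_vars_integrable[OF assms(1) ind int] by (simp add: exp_sum assms(1))
  have "expectation (\<lambda>\<omega>. exp (\<Sum>e\<in>G. \<bar>\<tau> e \<omega>\<bar>)) = (\<Prod>e\<in>G. expectation (\<lambda>\<omega>. exp \<bar>\<tau> e \<omega>\<bar>))"
    using indep_vars_lebesgue_integral[OF assms(1) ind int] by (simp add: exp_sum assms(1))
  also have "\<dots> = (\<Prod>e\<in>G. expectation (\<lambda>\<omega>. exp \<bar>\<tau> f \<omega>\<bar>))"
    using assms by (intro prod.cong refl expectation_exp_weight) auto
  finally show ?eq by simp
qed

text \<open>A Chernoff bound with parameter 1 along one fixed path of at most \<open>L\<close>
  edges.\<close>

lemma edist_tail:
  assumes "f \<in> lattice_edges" "y \<in> l1ball L"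
  shows "prob {\<omega> \<in> space M. C * real L < edist (W \<omega>) 0 y}
      \<le> (exp (- C) * expectation (\<lambda>\<omega>. exp \<bar>\<tau> f \<omega>\<bar>)) ^ L"
proof -
  obtain p where p: "p \<in> lattice_paths 0 y" "int (card (path_edges p)) \<le> l1norm y"
    using ex_short_path[of 0 y] by auto
  define G where "G = path_edges p"
  have G: "finite G" "G \<subseteq> lattice_edges" "card G \<le> L"
    using p assms(2) lattice_paths_edges[OF p(1)] by (auto simp: G_def l1ball_def)
  define h where "h \<omega> = exp (\<Sum>e\<in>G. \<bar>\<tau> e \<omega>\<bar>)" for \<omega>
  note mgf = mgf_edges[OF G(1,2) assms(1), folded h_def]
  note [measurable] = borel_measurable_integrable[OF mgf(1)]
  let ?m = "expectation (\<lambda>\<omega>. exp \<bar>\<tau> f \<omega>\<bar>)"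
  \<comment> \<open>This allows the exponent \<open>card G\<close> to be raised to \<open>L\<close>
    below.\<close>
  have "1 \<le> ?m"
    using integral_mono[OF _ exp_integrable[OF assms(1)], of "\<lambda>_. 1"] by (simp add: prob_space)
  have le: "edist (W \<omega>) 0 y \<le> (\<Sum>e\<in>G. \<bar>\<tau> e \<omega>\<bar>)" for \<omega>
  proof -
    have "path_time (\<lambda>e. \<bar>W \<omega> e\<bar>) p = (\<Sum>e\<in>G. \<bar>\<tau> e \<omega>\<bar>)"
      unfolding path_time_def G_def[symmetric] using G(2) by (intro sum.cong) (auto simp: W_def)
    then show ?thesis using edist_le[OF p(1), of "W \<omega>"] by simp
  qed
  have "{\<omega> \<in> space M. C * real L < edist (W \<omega>) 0 y} \<subseteq>
      {\<omega> \<in> space M. exp (C * real L) \<le> h \<omega>}"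
    using le by (auto simp: h_def intro: less_imp_le order_trans less_le_trans)
  then have "prob {\<omega> \<in> space M. C * real L < edist (W \<omega>) 0 y} \<le>
      prob {\<omega> \<in> space M. exp (C * real L) \<le> h \<omega>}"
    by (intro finite_measure_mono) measurable
  also have "\<dots> \<le> expectation h / exp (C * real L)"
    by (rule integral_Markov_inequality_measure[OF mgf(1), of "{}"]) (auto simp: h_def)
  also have "\<dots> = ?m ^ card G / exp (C * real L)" by (simp add: mgf(2))
  also have "\<dots> \<le> ?m ^ L / exp (C * real L)"
    using \<open>1 \<le> ?m\<close> G(3) by (intro divide_right_mono power_increasing) auto
  also have "\<dots> = (exp (- C) * ?m) ^ L"
    by (simp add: power_mult_distrib exp_of_nat_mult[symmetric] exp_minus divide_simps mult.commute)
  finally show ?thesis .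
qed

text \<open>A union bound: each point contributes at most \<open>exp (- L)\<close>, and the ball has
  only polynomially many points.\<close>

lemma ball_distances_tail:
  obtains C where "0 \<le> C"
    "(\<lambda>L. prob {\<omega> \<in> space M. \<exists>y\<in>l1ball L. C * real L < edist (W \<omega>) 0 y}) \<longlonglongrightarrow> 0"
proof -
  obtain f :: "(int ^ 'd) set" where f: "f \<in> lattice_edges"
    using infinite_lattice_edges by (metis all_not_in_conv finite.emptyI)
  let ?m = "expectation (\<lambda>\<omega>. exp \<bar>\<tau> f \<omega>\<bar>)"
  \<comment> \<open>The logarithm cancels the exponential moment of one weight; the extra 1 leaves
    decay \<open>exp (- 1)\<close> per edge.\<close>
  define C where "C = ln ?m + 1"
  have m: "1 \<le> ?m"
    using integral_mono[OF _ exp_integrable[OF f], of "\<lambda>_. 1"] by (simp add: prob_space)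
  have "exp (- C) * ?m = exp (- 1)"
    using m by (simp add: C_def exp_add exp_minus exp_diff inverse_eq_divide)
  have bound: "prob {\<omega> \<in> space M. \<exists>y\<in>l1ball L. C * real L < edist (W \<omega>) 0 y}
      \<le> 3 ^ CARD('d) * (real L ^ CARD('d) / exp (real L))" if "1 \<le> L" for L
  proof -
    let ?B = "l1ball L :: (int ^ 'd) set"
    have "{\<omega> \<in> space M. \<exists>y\<in>?B. C * real L < edist (W \<omega>) 0 y}
        = (\<Union>y\<in>?B. {\<omega> \<in> space M. C * real L < edist (W \<omega>) 0 y})" by auto
    then have "prob {\<omega> \<in> space M. \<exists>y\<in>?B. C * real L < edist (W \<omega>) 0 y}
        \<le> (\<Sum>y\<in>?B. prob {\<omega> \<in> space M. C * real L < edist (W \<omega>) 0 y})"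
      by (simp, intro finite_measure_subadditive_finite l1ball_finite_card(1)) auto
    also have "\<dots> \<le> (\<Sum>y\<in>?B. exp (- 1) ^ L)"
      using edist_tail[OF f, of _ L C] \<open>exp (- C) * ?m = exp (- 1)\<close> by (intro sum_mono) simp
    also have "\<dots> = real (card ?B) * exp (- real L)"
      by (simp add: exp_of_nat_mult[symmetric])
    also have "\<dots> \<le> real ((3 * L) ^ CARD('d)) * exp (- real L)"
    proof (intro mult_right_mono of_nat_mono)
      have "card ?B \<le> (2 * L + 1) ^ CARD('d)" by (rule l1ball_finite_card(2))
      also have "\<dots> \<le> (3 * L) ^ CARD('d)" using that by (intro power_mono) auto
      finally show "card ?B \<le> (3 * L) ^ CARD('d)" .
    qed auto
    finally show ?thesis by (simp add: power_mult_distrib exp_minus field_simps)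
  qed
  have "(\<lambda>L. real L ^ CARD('d) / exp (real L)) \<longlonglongrightarrow> 0"
    by (rule filterlim_compose[OF tendsto_power_div_exp_0 filterlim_real_sequentially])
  from tendsto_mult_right_zero[OF this] have lim: "(\<lambda>L. 3 ^ CARD('d) * (real L ^ CARD('d) / exp (real L))) \<longlonglongrightarrow> 0" .
  have "(\<lambda>L. prob {\<omega> \<in> space M. \<exists>y\<in>l1ball L. C * real L < edist (W \<omega>) 0 y}) \<longlonglongrightarrow> 0"
  proof (rule tendsto_sandwich[OF _ _ tendsto_const lim])
    show "eventually (\<lambda>L. prob {\<omega> \<in> space M. \<exists>y\<in>l1ball L. C * real L < edist (W \<omega>) 0 y}
        \<le> 3 ^ CARD('d) * (real L ^ CARD('d) / exp (real L))) sequentially"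
      using eventually_ge_at_top[of 1] by eventually_elim (rule bound)
  qed simp
  moreover have "0 \<le> C" using m by (simp add: C_def)
  ultimately show thesis using that by blast
qed

lemma edist_lower_prob:
  assumes "c < mu k"
  shows "(\<lambda>n. prob {\<omega> \<in> space M. edist (W \<omega>) 0 (axis k (int n)) < c * real n}) \<longlonglongrightarrow> 0"
proof -
  define A where "A n = {\<omega> \<in> space M. edist (W \<omega>) 0 (axis k (int n)) < c * real n}" for n
  have [measurable]: "A n \<in> events" for n unfolding A_def by measurable
  have "(\<lambda>n. expectation (indicat_real (A n))) \<longlonglongrightarrow> expectation (\<lambda>_. 0)"
  proof (rule integral_dominated_convergence[where w = "\<lambda>_. 1"])
    show "AE \<omega> in M. (\<lambda>n. indicat_real (A n) \<omega>) \<longlonglongrightarrow> 0"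
      using edist_tendsto[of k]
    proof eventually_elim
      case (elim \<omega>)
      from order_tendstoD(1)[OF elim assms] eventually_gt_at_top[of 0]
      have "eventually (\<lambda>n. indicat_real (A n) \<omega> = 0) sequentially"
      proof eventually_elim
        case (elim n)
        then have "c * real n < edist (W \<omega>) 0 (axis k (int n))" by (simp add: field_simps)
        then show ?case by (auto simp: A_def indicator_def)
      qed
      then show ?case by (rule tendsto_eventually)
    qed
    show "AE \<omega> in M. norm (indicat_real (A n) \<omega>) \<le> 1" for n
      by (intro AE_I2) (simp split: split_indicator)
  qed auto
  then show ?thesis unfolding A_def[symmetric] by simp
qed

section \<open>The slow ball: independence, deviation probability and rate\<close>

lemma prob_box:
  assumes "finite F" "F \<subseteq> lattice_edges" "f \<in> lattice_edges"
  shows "prob {\<omega> \<in> space M. \<forall>e\<in>F. m < \<tau> e \<omega>} = prob {\<omega> \<in> space M. m < \<tau> f \<omega>} ^ card F"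
proof (cases "F = {}")
  case False
  have eq: "prob {\<omega> \<in> space M. m < \<tau> e \<omega>} = measure (distr M borel (\<tau> e)) {m<..}" if "e \<in> lattice_edges" for e
    using measurable_weight[OF that] by (subst measure_distr) (auto intro!: arg_cong[where f = prob])
  have "{\<omega> \<in> space M. \<forall>e\<in>F. m < \<tau> e \<omega>} = (\<Inter>e\<in>F. \<tau> e -` {m<..} \<inter> space M)"
    using False by auto
  then have "prob {\<omega> \<in> space M. \<forall>e\<in>F. m < \<tau> e \<omega>} = (\<Prod>e\<in>F. prob (\<tau> e -` {m<..} \<inter> space M))"
    using indep_varsD[OF indep False assms(1,2), of "\<lambda>_. {m<..}"] by simp
  also have "\<dots> = (\<Prod>e\<in>F. prob {\<omega> \<in> space M. m < \<tau> f \<omega>})"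
  proof (intro prod.cong refl)
    fix e assume "e \<in> F"
    then have e: "e \<in> lattice_edges" using assms by auto
    have "\<tau> e -` {m<..} \<inter> space M = {\<omega> \<in> space M. m < \<tau> e \<omega>}" by auto
    then show "prob (\<tau> e -` {m<..} \<inter> space M) = prob {\<omega> \<in> space M. m < \<tau> f \<omega>}"
      using eq[OF e] eq[OF assms(3)] ident[OF e assms(3)] by simp
  qed
  finally show ?thesis by simp
qed (simp add: prob_space)

text \<open>Erasing the ball gives a function of the exterior weights alone, which is what allows
  the slow ball and the exterior travel time to be decoupled.\<close>

definition Wzero :: "nat \<Rightarrow> 'a \<Rightarrow> (int ^ 'd) set \<Rightarrow> real" where
  "Wzero L \<omega> = (\<lambda>e. if e \<in> ball_edges L then 0 else W \<omega> e)"

lemma prob_box_indep: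
  fixes L :: nat and m c :: real and z :: "int ^ 'd"
  defines "A \<equiv> {\<omega> \<in> space M. \<forall>e\<in>ball_edges L. m < \<tau> e \<omega>}"
    and "D \<equiv> {\<omega> \<in> space M. c \<le> edist (Wzero L \<omega>) 0 z}"
  shows "prob (A \<inter> D) = prob A * prob D" "D \<in> events" "A \<in> events"
proof -
  let ?F = "ball_edges L :: (int ^ 'd) set set" and ?E = "lattice_edges :: (int ^ 'd) set set"
  have F: "?F \<subseteq> ?E" "finite ?F" using ball_edges_finite_card(1) by (auto simp: ball_edges_def)
  \<comment> \<open>Extends an exterior configuration by zero weights in the ball, so that
    \<open>D\<close> becomes an event about the exterior restriction of the weights.\<close>
  define g where "g w = (\<lambda>e\<in>?E. if e \<in> ?F then 0 else w e)" for w :: "(int ^ 'd) set \<Rightarrow> real"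
  define XA where "XA = {w \<in> space (PiM ?F (\<lambda>_. borel)). \<forall>e\<in>?F. m < (w e :: real)}"
  define XD where "XD = {w \<in> space (PiM (?E - ?F) (\<lambda>_. borel)). c \<le> edist (g w) 0 z}"
  have XA: "XA \<in> sets (PiM ?F (\<lambda>_. borel))"
    unfolding XA_def using F(2) by measurable
  have "g \<in> measurable (PiM (?E - ?F) (\<lambda>_. borel)) weight_space"
    unfolding g_def
  proof (rule measurable_restrict)
    fix e assume e: "e \<in> ?E"
    show "(\<lambda>w. if e \<in> ?F then 0 else w e) \<in> borel_measurable (PiM (?E - ?F) (\<lambda>_. borel))"
    proof (cases "e \<in> ?F")
      case False
      then show ?thesis using e by (simp add: measurable_component_singleton)
    qed simp
  qed
  then have XD: "XD \<in> sets (PiM (?E - ?F) (\<lambda>_. borel))"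
    unfolding XD_def by measurable
  let ?X = "\<lambda>\<omega>. \<lambda>e\<in>?F. \<tau> e \<omega>" and ?Y = "\<lambda>\<omega>. \<lambda>e\<in>?E - ?F. \<tau> e \<omega>"
  have ind: "indep_var (PiM ?F (\<lambda>_. borel)) ?X (PiM (?E - ?F) (\<lambda>_. borel)) ?Y"
    using F by (intro indep_var_restrict[OF indep]) auto
  have "edist (g (?Y \<omega>)) 0 z = edist (Wzero L \<omega>) 0 z" for \<omega>
    by (rule edist_cong) (auto simp: g_def Wzero_def W_def)
  then have D: "?Y -` XD \<inter> space M = D"
    by (auto simp: XD_def D_def space_PiM)
  have A: "?X -` XA \<inter> space M = A"
    by (auto simp: XA_def A_def space_PiM)
  have "(\<lambda>\<omega>. (?X \<omega>, ?Y \<omega>)) -` (XA \<times> XD) \<inter> space M = A \<inter> D"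
    using A D by auto
  then show "prob (A \<inter> D) = prob A * prob D"
    using indep_varD[OF ind XA XD] unfolding A D by simp
  show "D \<in> events" using measurable_sets[OF indep_var_rv2[OF ind] XD] unfolding D .
  show "A \<in> events" using measurable_sets[OF indep_var_rv1[OF ind] XA] unfolding A .
qed

text \<open>On \<open>A \<inter> D\<close> the travel time is at least
  \<open>(C + 3) * L + (mu k - \<xi>) * n - C * L\<close>, and
  \<open>3 * L \<ge> 3 * \<xi> * n\<close> lifts this above \<open>(mu k + \<xi>) * n\<close>. The
  factors are \<open>q\<close> to the number of ball edges for \<open>A\<close> and at least 1/2 for
  \<open>D\<close>.\<close>

lemma deviation_prob_lower:
  assumes "0 \<le> C" and C: "(\<lambda>L. prob {\<omega> \<in> space M. \<exists>y\<in>l1ball L. C * real L < edist (W \<omega>) 0 y}) \<longlonglongrightarrow> 0"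
    and f: "f \<in> lattice_edges" and \<xi>: "0 < \<xi>" "\<xi> < 1/2"
  defines "q \<equiv> prob {\<omega> \<in> space M. C + 3 < \<tau> f \<omega>}"
  shows "eventually (\<lambda>n. q ^ card (ball_edges (nat \<lceil>\<xi> * real n\<rceil>) :: (int ^ 'd) set set) / 2
    \<le> prob {\<omega> \<in> space M. (mu k + \<xi>) * real n < edist (W \<omega>) 0 (axis k (int n))}) sequentially"
proof -
  define L where "L n = nat \<lceil>\<xi> * real n\<rceil>" for n :: nat
  have "filterlim L sequentially sequentially"
    unfolding L_def using \<xi>(1) by real_asymp
  from filterlim_compose[OF C this]
  have "eventually (\<lambda>n. prob {\<omega> \<in> space M. \<exists>y\<in>l1ball (L n). C * real (L n) < edist (W \<omega>) 0 y} < 1/4) sequentially"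
    by (rule order_tendstoD) simp
  moreover have "eventually (\<lambda>n. prob {\<omega> \<in> space M. edist (W \<omega>) 0 (axis k (int n)) < (mu k - \<xi>) * real n} < 1/4) sequentially"
    using \<xi> by (intro order_tendstoD(2)[OF edist_lower_prob]) auto
  \<comment> \<open>The target must not lie strictly inside the ball, since every path has to cross
    all its \<open>L n\<close> levels.\<close>
  moreover have "eventually (\<lambda>n. L n \<le> n) sequentially"
  proof -
    have "eventually (\<lambda>n. \<xi> * real n + 1 \<le> real n) sequentially" using \<xi> by real_asymp
    then show ?thesis unfolding L_def by eventually_elim linarith
  qed
  moreover have "eventually (\<lambda>n::nat. 0 < n) sequentially" by (rule eventually_gt_at_top)
  ultimately show ?thesis
    unfolding L_def[symmetric]
  proof eventually_elim
    case (elim n)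
    let ?z = "axis k (int n) :: int ^ 'd"
    define A where "A = {\<omega> \<in> space M. \<forall>e\<in>ball_edges (L n). C + 3 < \<tau> e \<omega>}"
    define D where "D = {\<omega> \<in> space M. (mu k - \<xi>) * real n - C * real (L n) \<le> edist (Wzero (L n) \<omega>) 0 ?z}"
    define U where "U = {\<omega> \<in> space M. edist (W \<omega>) 0 ?z < (mu k - \<xi>) * real n}"
    define V where "V = {\<omega> \<in> space M. \<exists>y\<in>l1ball (L n). C * real (L n) < edist (W \<omega>) 0 y}"
    have AD: "prob (A \<inter> D) = prob A * prob D" "D \<in> events" "A \<in> events"
      unfolding A_def D_def by (rule prob_box_indep)+
    have [measurable]: "U \<in> events" "V \<in> events"
    proof -
      show "U \<in> events" unfolding U_def by measurable
      have "V = (\<Union>y\<in>l1ball (L n). {\<omega> \<in> space M. C * real (L n) < edist (W \<omega>) 0 y})"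
        by (auto simp: V_def)
      also have "\<dots> \<in> events" by (intro sets.finite_UN l1ball_finite_card(1)) measurable
      finally show "V \<in> events" .
    qed
    \<comment> \<open>\<open>U\<close> and \<open>V\<close> are events of the unmodified
      environment, each of probability below 1/4; outside both, the exit argument yields the bound
      for the erased one.\<close>
    have "space M - (U \<union> V) \<subseteq> D"
    proof
      fix \<omega> assume \<omega>: "\<omega> \<in> space M - (U \<union> V)"
      then have "edist (W \<omega>) 0 ?z - C * real (L n) \<le> edist (Wzero (L n) \<omega>) 0 ?z"
        by (intro edist_exit_lower) (auto simp: V_def Wzero_def not_less)
      then show "\<omega> \<in> D" using \<omega> by (auto simp: D_def U_def)
    qed
    then have "prob (space M - (U \<union> V)) \<le> prob D" using AD by (intro finite_measure_mono) auto
    moreover have "prob (space M - (U \<union> V)) = 1 - prob (U \<union> V)" by (rule prob_compl) measurable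
    moreover have "prob (U \<union> V) \<le> prob U + prob V" by (rule measure_Un_le) measurable
    ultimately have "1/2 \<le> prob D" using elim(1,2) by (simp add: U_def V_def)
    have "prob A = q ^ card (ball_edges (L n) :: (int ^ 'd) set set)"
      unfolding A_def q_def using ball_edges_finite_card(1) f
      by (intro prob_box) (auto simp: ball_edges_def)
    then have "q ^ card (ball_edges (L n) :: (int ^ 'd) set set) / 2 \<le> prob A * prob D"
      using mult_left_mono[OF \<open>1/2 \<le> prob D\<close> measure_nonneg, of M A] by simp
    also have "\<dots> = prob (A \<inter> D)" using AD by simp
    also have "\<dots> \<le> prob {\<omega> \<in> space M. (mu k + \<xi>) * real n < edist (W \<omega>) 0 ?z}"
    proof (rule finite_measure_mono)
      show "A \<inter> D \<subseteq> {\<omega> \<in> space M. (mu k + \<xi>) * real n < edist (W \<omega>) 0 ?z}"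
      proof
        fix \<omega> assume \<omega>: "\<omega> \<in> A \<inter> D"
        have "(C + 3) * real (L n) + edist (Wzero (L n) \<omega>) 0 ?z \<le> edist (W \<omega>) 0 ?z"
        proof (rule edist_ball_lower)
          show "int (L n) \<le> l1norm ?z" using elim by (simp add: l1norm_axis)
          show "C + 3 \<le> \<bar>W \<omega> e\<bar>" if "e \<in> ball_edges (L n)" for e
            using \<omega> that by (force simp: A_def W_def ball_edges_def)
        qed (auto simp: Wzero_def \<open>0 \<le> C\<close>)
        moreover have "(mu k - \<xi>) * real n - C * real (L n) \<le> edist (Wzero (L n) \<omega>) 0 ?z"
          using \<omega> by (simp add: D_def)
        moreover have "\<xi> * real n \<le> real (L n)" unfolding L_def by linarith
        moreover have "0 < \<xi> * real n" using \<xi> elim by simp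
        ultimately have "(mu k + \<xi>) * real n < edist (W \<omega>) 0 ?z" by (simp add: algebra_simps)
        then show "\<omega> \<in> {\<omega> \<in> space M. (mu k + \<xi>) * real n < edist (W \<omega>) 0 ?z}"
          using \<omega> by (simp add: A_def)
      qed
    qed measurable
    finally show ?case .
  qed
qed

text \<open>Taking logarithms, the cost is \<open>- ln q\<close> for each ball edge plus
  \<open>ln 2\<close>, and the number of edges is at most \<open>d * (5 * \<xi> * n) ^ d\<close> for
  large \<open>n\<close>.\<close>

lemma upper_rate_le:
  assumes nonneg: "\<And>e \<omega>. e \<in> lattice_edges \<Longrightarrow> \<omega> \<in> space M \<Longrightarrow> 0 \<le> \<tau> e \<omega>"
    and unbounded: "\<And>e m. e \<in> lattice_edges \<Longrightarrow> 0 < m \<Longrightarrow> \<P>(\<omega> in M. \<tau> e \<omega> > m) > 0"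
  obtains K where "\<And>\<xi>. 0 < \<xi> \<Longrightarrow> \<xi> < 1/2 \<Longrightarrow> upper_rate M \<tau> k \<xi> \<le> ereal (K * \<xi> ^ CARD('d))"
proof -
  obtain f :: "(int ^ 'd) set" where f: "f \<in> lattice_edges"
    using infinite_lattice_edges by (metis all_not_in_conv finite.emptyI)
  obtain C where C: "0 \<le> C"
    "(\<lambda>L. prob {\<omega> \<in> space M. \<exists>y\<in>l1ball L. C * real L < edist (W \<omega>) 0 y}) \<longlonglongrightarrow> 0"
    by (rule ball_distances_tail)
  \<comment> \<open>\<open>C\<close> and hence \<open>q\<close> are fixed before \<xi>, so
    \<open>K\<close> does not depend on \<xi>; unboundedness of the weights makes \<open>q\<close>
    positive.\<close>
  define q where "q = prob {\<omega> \<in> space M. C + 3 < \<tau> f \<omega>}"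
  have q: "0 < q" "q \<le> 1" using unbounded[OF f, of "C + 3"] C(1) by (auto simp: q_def)
  have time_constant: "time_constant M \<tau> (axis k 1) = mu k"
    by (rule time_constant_eq) (rule nonneg)
  define d where "d = CARD('d)"
  have "0 < d" by (simp add: d_def)
  \<comment> \<open>The factor \<open>5 ^ d * real d\<close> comes from the edge count, and the
    summand 1 absorbs \<open>ln 2 / n ^ d\<close>, which is eventually below
    \<open>\<xi> ^ d\<close>.\<close>
  define K where "K = - ln q * (5 ^ d * real d) + 1"
  show thesis
  proof (rule that)
    fix \<xi> :: real assume \<xi>: "0 < \<xi>" "\<xi> < 1/2"
    have "eventually (\<lambda>n. ln 2 / real n ^ d < \<xi> ^ d) sequentially"
    proof -
      have "filterlim (\<lambda>n. real n ^ d) at_top sequentially"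
        by (rule filterlim_pow_at_top[OF \<open>0 < d\<close> filterlim_real_sequentially])
      then have "(\<lambda>n. ln 2 / real n ^ d) \<longlonglongrightarrow> 0"
        by (intro tendsto_divide_0[OF tendsto_const] filterlim_at_top_imp_at_infinity)
      then show ?thesis by (rule order_tendstoD) (use \<xi> in auto)
    qed
    \<comment> \<open>From here \<open>L \<le> \<xi> * n + 1\<close> gives
      \<open>2 * L + 1 \<le> 2 * \<xi> * n + 3 \<le> 5 * \<xi> * n\<close>.\<close>
    moreover have "eventually (\<lambda>n. 1 \<le> \<xi> * real n) sequentially" using \<xi> by real_asymp
    ultimately have "eventually (\<lambda>n. ereal (1 / real n ^ CARD('d)) *
        neg_log (\<P>(\<omega> in M. passage_time (\<lambda>e. \<tau> e \<omega>) 0 (real n *\<^sub>R axis k 1)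
          > (time_constant M \<tau> (axis k 1) + \<xi>) * real n)) \<le> ereal (K * \<xi> ^ CARD('d))) sequentially"
      using deviation_prob_lower[OF C f \<xi>, of k, folded q_def]
    proof eventually_elim
      case (elim n)
      define L where "L = nat \<lceil>\<xi> * real n\<rceil>"
      define N where "N = card (ball_edges L :: (int ^ 'd) set set)"
      define P where "P = prob {\<omega> \<in> space M. (mu k + \<xi>) * real n < edist (W \<omega>) 0 (axis k (int n))}"
      have P: "q ^ N / 2 \<le> P" using elim by (simp add: P_def N_def L_def)
      have "0 < n" using elim(2) by (cases n) auto
      have "real N \<le> real ((2 * L + 1) ^ d * d)"
        using ball_edges_finite_card(2)[where 'd = 'd and L = L] unfolding N_def d_def by (rule of_nat_mono)
      also have "\<dots> = (2 * real L + 1) ^ d * real d" by (simp add: algebra_simps)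
      also have "\<dots> \<le> (5 * (\<xi> * real n)) ^ d * real d"
      proof (intro mult_right_mono power_mono)
        have "real L \<le> \<xi> * real n + 1" using elim(2) unfolding L_def by linarith
        then show "2 * real L + 1 \<le> 5 * (\<xi> * real n)" using elim(2) by simp
      qed auto
      finally have N: "real N \<le> 5 ^ d * real d * \<xi> ^ d * real n ^ d"
        by (simp add: power_mult_distrib mult_ac)
      have "0 < q ^ N / 2" using q by simp
      \<comment> \<open>Positivity of \<open>P\<close> selects the finite branch of
        \<open>neg_log\<close>.\<close>
      then have "0 < P" "ln (q ^ N / 2) \<le> ln P" using P by auto
      then have "- ln P \<le> real N * (- ln q) + ln 2" using q by (simp add: ln_div ln_realpow)
      also have "\<dots> \<le> 5 ^ d * real d * \<xi> ^ d * real n ^ d * (- ln q) + \<xi> ^ d * real n ^ d"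
      proof (rule add_mono)
        show "real N * (- ln q) \<le> 5 ^ d * real d * \<xi> ^ d * real n ^ d * (- ln q)"
          using N q by (intro mult_right_mono) auto
        show "ln 2 \<le> \<xi> ^ d * real n ^ d" using elim(1) \<open>0 < n\<close> by (simp add: divide_less_eq)
      qed
      also have "\<dots> = K * \<xi> ^ d * real n ^ d" by (simp add: K_def algebra_simps)
      finally have "(- ln P) / real n ^ d \<le> K * \<xi> ^ d" using \<open>0 < n\<close> by (subst pos_divide_le_eq) auto
      moreover have "{\<omega> \<in> space M. passage_time (\<lambda>e. \<tau> e \<omega>) 0 (real n *\<^sub>R axis k 1)
          > (time_constant M \<tau> (axis k 1) + \<xi>) * real n}
          = {\<omega> \<in> space M. (mu k + \<xi>) * real n < edist (W \<omega>) 0 (axis k (int n))}"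
        by (intro Collect_cong conj_cong refl) (simp add: passage_time_eq nonneg time_constant)
      ultimately show ?case using \<open>0 < P\<close> by (simp add: neg_log_def P_def d_def)
    qed
    then show "upper_rate M \<tau> k \<xi> \<le> ereal (K * \<xi> ^ CARD('d))"
      unfolding upper_rate_def by (rule Limsup_bounded)
  qed
qed

end

theorem theorem1p13:
  fixes M :: "'a measure"
    and \<tau> :: "(int ^ 'd::finite) set \<Rightarrow> 'a \<Rightarrow> real"
    and k :: 'd
    and r \<alpha> \<beta> :: real
  assumes "prob_space M"
    and "CARD('d) \<ge> 2"
    and nonneg: "\<And>e \<omega>. e \<in> lattice_edges \<Longrightarrow> \<omega> \<in> space M \<Longrightarrow> 0 \<le> \<tau> e \<omega>"
    and indep: "prob_space.indep_vars M (\<lambda>_. borel) \<tau> lattice_edges"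
    and ident: "\<And>e f. e \<in> lattice_edges \<Longrightarrow> f \<in> lattice_edges \<Longrightarrow>
                  distr M borel (\<tau> e) = distr M borel (\<tau> f)"
    and "r > real CARD('d)" and "\<alpha> > 0" and "\<beta> > 0"
    and tail: "\<And>e t. e \<in> lattice_edges \<Longrightarrow> 0 \<le> t \<Longrightarrow>
                 \<P>(\<omega> in M. \<tau> e \<omega> \<ge> t) \<le> \<beta> * exp (- \<alpha> * t powr r)"
    and unbounded: "\<And>e m. e \<in> lattice_edges \<Longrightarrow> 0 < m \<Longrightarrow> \<P>(\<omega> in M. \<tau> e \<omega> > m) > 0"
  shows "Limsup (at_right 0) (\<lambda>\<xi>. ereal (1 / \<xi> ^ CARD('d)) * upper_rate M \<tau> k \<xi>) < \<infinity>"
proof -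
  interpret prob_space M by fact
  interpret percolation M \<tau>
  proof
    show "integrable M (\<lambda>\<omega>. exp \<bar>\<tau> e \<omega>\<bar>)" if e: "e \<in> lattice_edges" for e
    proof -
      have "\<tau> e \<in> borel_measurable M" using indep e by (auto simp: indep_vars_def)
      then have "integrable M (\<lambda>\<omega>. exp (\<tau> e \<omega>))"
        using nonneg[OF e] tail[OF e] assms(2,6-8) by (intro exp_integrable_of_tail[of "\<tau> e" r \<alpha> \<beta>]) auto
      then show ?thesis
        using nonneg[OF e] by (subst Bochner_Integration.integrable_cong[OF refl, of _ _ "\<lambda>\<omega>. exp (\<tau> e \<omega>)"]) auto
    qed
  qed (fact indep, fact ident)
  obtain K where K: "\<And>\<xi>. 0 < \<xi> \<Longrightarrow> \<xi> < 1/2 \<Longrightarrow> upper_rate M \<tau> k \<xi> \<le> ereal (K * \<xi> ^ CARD('d))"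
    using upper_rate_le[OF nonneg unbounded] by blast
  have "eventually (\<lambda>\<xi>::real. ereal (1 / \<xi> ^ CARD('d)) * upper_rate M \<tau> k \<xi> \<le> ereal K) (at_right 0)"
    unfolding eventually_at_right_field
  proof (intro exI[of _ "1/2"] conjI allI impI)
    fix \<xi> :: real assume \<xi>: "0 < \<xi>" "\<xi> < 1/2"
    have "ereal (1 / \<xi> ^ CARD('d)) * upper_rate M \<tau> k \<xi> \<le> ereal (1 / \<xi> ^ CARD('d)) * ereal (K * \<xi> ^ CARD('d))"
      using K[OF \<xi>] \<xi> by (intro ereal_mult_left_mono) auto
    also have "\<dots> = ereal K" using \<xi> by simp
    finally show "ereal (1 / \<xi> ^ CARD('d)) * upper_rate M \<tau> k \<xi> \<le> ereal K" .
  qed simp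
  then have "Limsup (at_right 0) (\<lambda>\<xi>. ereal (1 / \<xi> ^ CARD('d)) * upper_rate M \<tau> k \<xi>) \<le> ereal K"
    by (rule Limsup_bounded)
  then show ?thesis by (rule le_less_trans) simp
qed

end
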